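(* The spaces $\mathcal{WH}^\circ$ and $\mathcal{WBH}^\circ$ are $h$-equal but not homotopy equivalent; likewise the compact spaces $\mathcal{WH}$ and $\mathcal{WBH}$ are $h$-equal but not homotopy equivalent.
   Context: $X=_hY$ ($h$-equal) means there exist maps $f:X\to Y,\ g:Y\to X$ with $g\circ f\simeq\mathrm{id}_X$ and maps $f':Y\to X,\ g':X\to Y$ with $g'\circ f'\simeq\mathrm{id}_Y$. Double broom $\mathcal{B}\subset\mathbb{R}^2$: $v=(0,0)$, $a_0=(0,1)$, $b_0=(0,-1)$, $a_n=(1/n,0)$, $b_n=(-1/n,0)$ ($n\ge1$), $\mathcal{B}=[v,a_0]\cup[v,b_0]\cup\bigcup_{n\ge1}([a_n,a_0]\cup[b_n,b_0])$ with center $v$. Hairy disk $\mathcal{H}$: the closed unit disk $D^2$ with center $c$, a countable dense subset $M=\{m_i\}$ of $\partial D^2$, and for each $i$ a copy $\mathcal{B}_{m_i}$ of $\mathcal{B}$ attached by its center at $m_i$, pairwise disjoint, meeting $D^2$ only in $m_i$, diameters tending to $0$. For disjoint $X,Y\subset\mathbb{R}^N$, $X\curlyvee_{x,y}Y=X\cup[x,y]\cup Y$ with $[x,y]$ an arc from $x\in X$ to $y\in Y$ whose interior misses $X\cup Y$. With $c(k)=(-1/k,0,0)$ and $\mathcal{H}(k)$ a copy of $\mathcal{H}$ of diameter $1/k$ in the plane $\{x=-1/k\}$ centered at $c(k)$: $\mathcal{WH}^\circ=\mathcal{H}(1)\curlyvee_{c(1),c(2)}\mathcal{H}(2)\curlyvee_{c(2),c(3)}\cdots$,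 $\mathcal{WBH}^\circ=\mathcal{B}\curlyvee_{b,c'(1)}\mathcal{H}'(1)\curlyvee_{c'(1),c'(2)}\mathcal{H}'(2)\cdots$ (with $b$ the center of the extra broom, $\mathcal{H}'(k),c'(k)$ analogous factors), $\mathcal{WH}=\mathcal{WH}^\circ\cup\{(0,0,0)\}$, $\mathcal{WBH}=\mathcal{WBH}^\circ\cup\{(0,0,0)\}$. *)

theory Defs
  imports "HOL-Analysis.Analysis"
begin

definition hdominated :: "'a::topological_space set \<Rightarrow> 'b::topological_space set \<Rightarrow> bool" where
  "hdominated X Y \<longleftrightarrow> (\<exists>f g. continuous_map (top_of_set X) (top_of_set Y) f \<and>
      continuous_map (top_of_set Y) (top_of_set X) g \<and>
      homotopic_with (\<lambda>h. True) (top_of_set X) (top_of_set X) (g \<circ> f) id)"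

definition h_equal :: "'a::topological_space set \<Rightarrow> 'b::topological_space set \<Rightarrow> bool" where
  "h_equal X Y \<longleftrightarrow> hdominated X Y \<and> hdominated Y X"

definition double_broom :: "(real \<times> real) set" where
  "double_broom = closed_segment (0,0) (0,1) \<union> closed_segment (0,0) (0,-1) \<union>
     (\<Union>n\<in>{1::nat..}. closed_segment (1 / real n, 0) (0,1) \<union> closed_segment (- 1 / real n, 0) (0,-1))"

definition hairy_disk :: "(real \<times> real) set \<Rightarrow> bool" where
  "hairy_disk H \<longleftrightarrow> (\<exists>(m::nat \<Rightarrow> real \<times> real) (g::nat \<Rightarrow> real \<times> real \<Rightarrow> real \<times> real).
      inj m \<and> range m \<subseteq> sphere 0 1 \<and> sphere 0 1 \<subseteq> closure (range m) \<and>
      (\<forall>i. continuous_on double_broom (g i) \<and> inj_on (g i) double_broom \<and> g i (0,0) = m i \<and>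
           g i ` double_broom \<inter> cball 0 1 = {m i}) \<and>
      (\<forall>i j. i \<noteq> j \<longrightarrow> g i ` double_broom \<inter> g j ` double_broom = {}) \<and>
      ((\<lambda>i. diameter (g i ` double_broom)) \<longlonglongrightarrow> 0) \<and>
      H = cball 0 1 \<union> (\<Union>i. g i ` double_broom))"

definition hcopy :: "(real \<times> real) set \<Rightarrow> nat \<Rightarrow> (real \<times> real \<times> real) set" where
  "hcopy H k = (\<lambda>(a,b). (- 1 / real k, a / (real k * diameter H), b / (real k * diameter H))) ` H"

text \<open>the union of the connecting arcs [c(k), c(k+1)], k \<ge> 1 (straight segments on the x-axis)\<close>
definition axis_arcs :: "(real \<times> real \<times> real) set" where
  "axis_arcs = {(x,0,0) | x. -1 \<le> x \<and> x < 0}"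

definition WH_o :: "(real \<times> real) set \<Rightarrow> (real \<times> real \<times> real) set" where
  "WH_o H = (\<Union>k\<in>{1::nat..}. hcopy H k) \<union> axis_arcs"

text \<open>extra broom: copy of diameter 1 in the plane x = -1 centered at b = (-1,0,0);
  the hairy disks H'(k) = H(k+1) sit in the planes x = -1/(k+1).\<close>
definition broom_copy :: "(real \<times> real \<times> real) set" where
  "broom_copy = (\<lambda>(a,b). (-1, a / 2, b / 2)) ` double_broom"

definition WBH_o :: "(real \<times> real) set \<Rightarrow> (real \<times> real \<times> real) set" where
  "WBH_o H = broom_copy \<union> (\<Union>k\<in>{2::nat..}. hcopy H k) \<union> axis_arcs"

definition WH :: "(real \<times> real) set \<Rightarrow> (real \<times> real \<times> real) set" where
  "WH H = WH_o H \<union> {(0,0,0)}"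

definition WBH :: "(real \<times> real) set \<Rightarrow> (real \<times> real \<times> real) set" where
  "WBH H = WBH_o H \<union> {(0,0,0)}"

end

theory Submission
  imports Defs
begin

text \<open>
  The center \<open>v\<close> of a double broom is homotopically fixed. Under a homotopy of the inclusion of a
  neighbourhood, the nearby hairs of one half are carried along inside themselves, so the
  trajectory of \<open>v\<close> stays in that half as long as it stays near \<open>v\<close>; the same holds for the other
  half, and the two halves meet only in \<open>v\<close>. In \<open>WH\<close> every boundary circle of a disk is therefore
  fixed pointwise by any map homotopic to the identity, because the centers of the attached brooms
  are dense in it.

  Let \<open>f\<close> and \<open>h\<close> be homotopy inverse maps between \<open>WH\<close> and \<open>WBH\<close>, let \<open>b\<close> be the center of the extra
  broom, and \<open>x = h b\<close>, so that \<open>f x = b\<close>. If \<open>x\<close> had a neighbourhood that is null-homotopic in \<open>WH\<close>,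
  then so would \<open>b\<close> in \<open>WBH\<close>, which is impossible; this excludes the axis, the open disks and the
  brooms without their centers. The origin is excluded because \<open>WH\<close> is locally connected there. Hence
  \<open>x\<close> lies on a boundary circle. But \<open>f\<close> is injective on this circle, and no simple closed curve passes
  through \<open>b\<close>, since \<open>WBH\<close> falls apart into three legs when \<open>b\<close> is removed.

  The space \<open>WH\<close> is homeomorphic to a retract of \<open>WBH\<close> (shift all factors by one). Conversely \<open>WBH\<close> is
  homeomorphic to a retract of \<open>WH\<close>: map the extra broom to a broom of \<open>H(1)\<close> and the arc at \<open>b\<close> to a
  radius, and retract \<open>H(1)\<close> by sending a point of the disk to its norm.
\<close>

section \<open>The geometry of the double broom\<close>

text \<open>The half with apex \<open>(0, 1)\<close>, described height by height: at height
  \<open>y\<close> the hair with foot \<open>(1/n, 0)\<close> has abscissa \<open>(1 - y)/n\<close>,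
  and the handle has abscissa 0. The other half is the image under negation, so that only one half
  has to be studied.\<close>

definition upper_broom :: "(real \<times> real) set" where
  "upper_broom = {p. 0 \<le> snd p \<and> snd p \<le> 1 \<and>
     (fst p = 0 \<or> (\<exists>n\<ge>1::nat. fst p = (1 - snd p) / real n))}"

text \<open>The apex is left out: without it the hairs are pairwise disjoint and each is open in the
  broom.\<close>

definition hair :: "nat \<Rightarrow> (real \<times> real) set" where
  "hair n = {p. 0 \<le> snd p \<and> snd p < 1 \<and> fst p = (1 - snd p) / real n}"

lemma closed_segment_to_apex:
  "closed_segment (s, 0) (0, 1) = {p::real \<times> real. 0 \<le> snd p \<and> snd p \<le> 1 \<and> fst p = (1 - snd p) * s}"
  by (auto simp: closed_segment_def)

lemma closed_segment_to_lower_apex: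
  "closed_segment (s, 0) (0, -1) = uminus ` closed_segment (- s, 0) (0, 1 :: real)"
  for s :: real
proof -
  have "uminus ` closed_segment (- s, 0) (0, 1 :: real) = closed_segment (s, 0) (0, -1)"
    using closed_segment_linear_image[of uminus "(- s, 0)" "(0, 1 :: real)"]
    by (simp add: linear_uminus)
  then show ?thesis by simp
qed

lemma upper_broom_segments:
  "upper_broom = closed_segment (0,0) (0,1) \<union> (\<Union>n\<in>{1::nat..}. closed_segment (1 / real n, 0) (0,1))"
  unfolding closed_segment_to_apex upper_broom_def by auto

lemma double_broom_eq: "double_broom = upper_broom \<union> uminus ` upper_broom"
  unfolding double_broom_def upper_broom_segments closed_segment_to_lower_apex image_Un image_UN
  by auto

lemma upper_broom_Int_lower: "upper_broom \<inter> uminus ` upper_broom = {0}"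
proof -
  have "p = 0" if "p \<in> upper_broom" "- p \<in> upper_broom" for p
  proof -
    have "0 \<le> snd q \<and> 0 \<le> fst q" if "q \<in> upper_broom" for q
      using that unfolding upper_broom_def by auto
    from this[OF that(1)] this[OF that(2)] have "snd p = 0" "0 \<le> fst p" "0 \<le> fst (- p)"
      by auto
    then show ?thesis by (simp add: prod_eq_iff)
  qed
  moreover have "0 \<in> upper_broom" by (simp add: upper_broom_def)
  ultimately show ?thesis by force
qed

text \<open>The half broom is a cone over its feet, a convergent sequence with its limit. As a
  continuous image of a compact product it is compact.\<close>

lemma upper_broom_image:
  "upper_broom = (\<lambda>(s, y). ((1 - y) * s, y)) ` (insert 0 (range (\<lambda>n. 1 / real (Suc n))) \<times> {0..1})"
  (is "_ = ?f ` _")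
proof (intro equalityI subsetI)
  fix p assume p: "p \<in> upper_broom"
  obtain x y where xy: "p = (x, y)" by (cases p)
  from p xy consider "x = 0" | n :: nat where "n \<ge> 1" "x = (1 - y) / real n"
    by (auto simp: upper_broom_def)
  then show "p \<in> ?f ` (insert 0 (range (\<lambda>n. 1 / real (Suc n))) \<times> {0..1})"
  proof cases
    case 1
    then show ?thesis
      using p xy by (intro image_eqI[of _ _ "(0, y)"]) (auto simp: upper_broom_def)
  next
    case 2
    then have "1 / real n \<in> range (\<lambda>n. 1 / real (Suc n))"
      by (intro image_eqI[of _ _ "n - 1"]) auto
    then show ?thesis
      using 2 p xy by (intro image_eqI[of _ _ "(1 / real n, y)"]) (auto simp: upper_broom_def)
  qed
next
  fix p assume "p \<in> ?f ` (insert 0 (range (\<lambda>n. 1 / real (Suc n))) \<times> {0..1})"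
  then obtain s y where p: "p = ((1 - y) * s, y)" and y: "0 \<le> y" "y \<le> 1"
    and s: "s = 0 \<or> (\<exists>n. s = 1 / real (Suc n))" by fastforce
  from s show "p \<in> upper_broom"
  proof
    assume "s = 0" then show ?thesis using p y by (auto simp: upper_broom_def)
  next
    assume "\<exists>n. s = 1 / real (Suc n)"
    then obtain n where "s = 1 / real (Suc n)" ..
    then have "Suc n \<ge> 1 \<and> fst p = (1 - snd p) / real (Suc n)" using p by simp
    then show ?thesis using p y unfolding upper_broom_def by auto
  qed
qed

lemma compact_upper_broom: "compact upper_broom"
proof -
  have "compact (insert 0 (range (\<lambda>n. 1 / real (Suc n))))"
    by (rule compact_sequence_with_limit)
      (use LIMSEQ_inverse_real_of_nat in \<open>simp add: inverse_eq_divide\<close>)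
  then show ?thesis
    unfolding upper_broom_image
    by (intro compact_continuous_image compact_Times)
      (auto intro!: continuous_intros simp: case_prod_unfold)
qed

lemma compact_double_broom: "compact double_broom"
  unfolding double_broom_eq
  by (intro compact_Un compact_upper_broom compact_continuous_image) (auto intro: continuous_intros)

lemma uminus_double_broom [simp]: "uminus ` double_broom = double_broom"
  by (auto simp: double_broom_eq image_Un image_image)

lemma zero_in_brooms [simp]: "0 \<in> upper_broom" "0 \<in> double_broom"
  by (auto simp: double_broom_eq upper_broom_def)

lemma apex_in_brooms [simp]: "(0, 1) \<in> upper_broom" "(0, 1) \<in> double_broom"
  by (auto simp: double_broom_eq upper_broom_def)

lemma upper_subset_double: "upper_broom \<subseteq> double_broom"
  by (auto simp: double_broom_eq)

lemma hair_subset_upper: "n \<ge> 1 \<Longrightarrow> hair n \<subseteq> upper_broom - {0}"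
  by (auto simp: hair_def upper_broom_def)

lemma upper_broom_cases:
  assumes "p \<in> upper_broom"
  obtains "fst p = 0" "0 \<le> snd p" "snd p \<le> 1" | n where "n \<ge> 1" "p \<in> hair n"
proof (cases "snd p = 1")
  case True then show ?thesis using assms that by (auto simp: upper_broom_def)
next
  case False then show ?thesis using assms that by (auto simp: upper_broom_def hair_def)
qed

lemma base_point_in_hair: "(1 / real n, 0) \<in> hair n"
  by (simp add: hair_def)

text \<open>Two lines through the apex, with feet at \<open>1/(n + 1/2)\<close> and
  \<open>1/(n - 1/2)\<close>, bound an open wedge that contains no other hair.\<close>

lemma open_hair:
  assumes n: "n \<ge> 1"
  shows "openin (top_of_set double_broom) (hair n)"
proof -
  define U where "U = {p::real \<times> real. (1 - snd p) / (real n + 1/2) < fst p} \<inter>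
    {p. fst p < (1 - snd p) / (real n - 1/2)}"
  have "open U" unfolding U_def
    using n by (intro open_Int open_Collect_less continuous_intros) auto
  moreover have "hair n = double_broom \<inter> U"
  proof (intro equalityI subsetI)
    fix p assume p: "p \<in> hair n"
    then have "p \<in> double_broom" using hair_subset_upper[OF n] upper_subset_double by auto
    moreover have "p \<in> U"
      using p n by (auto simp: U_def hair_def intro!: divide_strict_left_mono mult_pos_pos)
    ultimately show "p \<in> double_broom \<inter> U" ..
  next
    fix p assume p: "p \<in> double_broom \<inter> U"
    \<comment> \<open>Comparing the two lines shows that \<open>p\<close> lies below the apex; above
      it their order is reversed.\<close>
    have "(1 - snd p) / (real n + 1/2) < (1 - snd p) / (real n - 1/2)"
      using p by (auto simp: U_def)
    then have lt: "snd p < 1"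
      using n by (cases "snd p < 1") (auto simp: field_simps)
    then have "0 < (1 - snd p) / (real n + 1/2)" by simp
    then have pos: "0 < fst p" using p by (auto simp: U_def)
    then have "p \<in> upper_broom"
      using p by (auto simp: double_broom_eq upper_broom_def divide_less_0_iff)
    then obtain m where m: "m \<ge> 1" "p \<in> hair m"
      using pos by (metis upper_broom_cases less_irrefl)
    then have "(1 - snd p) * (1 / (real n + 1/2)) < (1 - snd p) * (1 / real m)"
        "(1 - snd p) * (1 / real m) < (1 - snd p) * (1 / (real n - 1/2))"
      using p by (simp_all add: U_def hair_def)
    then have "1 / (real n + 1/2) < 1 / real m" "1 / real m < 1 / (real n - 1/2)"
      using lt by (simp_all only: mult_less_cancel_left_pos diff_gt_0_iff_gt)
    then have "real m < real n + 1/2" "real n - 1/2 < real m"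
      using m n by (auto simp: field_simps)
    then have "real m < real (n + 1)" "real n < real (m + 1)" by linarith+
    then have "m = n" unfolding of_nat_less_iff by simp
    then show "p \<in> hair n" using m by simp
  qed
  ultimately show ?thesis by (auto simp: openin_open)
qed

text \<open>Adding the apex turns the hair into a closed segment. Together with
  \<open>open_hair\<close> this makes the hair clopen in sets that miss the apex.\<close>

lemma compact_hair: "compact (insert (0, 1) (hair n))"
proof -
  have "insert (0, 1) (hair n) = closed_segment (1 / real n, 0) (0, 1)"
    unfolding closed_segment_to_apex hair_def by (auto simp: prod_eq_iff)
  then show ?thesis by simp
qed

lemma starlike_upper:
  assumes "p \<in> upper_broom" shows "closed_segment p (0, 1) \<subseteq> upper_broom"
proof -
  consider "fst p = 0" | n where "n \<ge> 1" "p \<in> closed_segment (1 / real n, 0) (0, 1)"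
    using assms unfolding upper_broom_segments closed_segment_to_apex by auto
  then show ?thesis
  proof cases
    case 1
    then have "p \<in> closed_segment (0, 0) (0, 1)"
      using assms unfolding closed_segment_to_apex by (simp add: upper_broom_def)
    then have "closed_segment p (0, 1) \<subseteq> closed_segment (0, 0) (0, 1)"
      by (simp add: subset_closed_segment)
    then show ?thesis unfolding upper_broom_segments by auto
  next
    case 2
    then have "closed_segment p (0, 1) \<subseteq> closed_segment (1 / real n, 0) (0, 1)"
      by (simp add: subset_closed_segment)
    then show ?thesis using 2 unfolding upper_broom_segments by auto
  qed
qed

section \<open>Brooms that are open in the ambient space away from their center\<close>

text \<open>Since the double broom is compact, such an \<open>e\<close> is an embedding. Openness is
  required only off the center \<open>e 0\<close>, because the rest of the space may be attached
  there.\<close>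

definition broom_at :: "'a::metric_space set \<Rightarrow> (real \<times> real \<Rightarrow> 'a) \<Rightarrow> bool" where
  "broom_at Z e \<longleftrightarrow> continuous_on double_broom e \<and> inj_on e double_broom \<and>
     e ` double_broom \<subseteq> Z \<and> openin (top_of_set Z) (e ` (double_broom - {0}))"

text \<open>Negation exchanges the two halves, so every statement about the upper half also yields
  one about the lower half.\<close>

lemma broom_at_uminus:
  assumes "broom_at Z e" shows "broom_at Z (e \<circ> uminus)"
proof -
  have "uminus ` (double_broom - {0}) = double_broom - {0}"
    by (subst image_set_diff) (auto simp: inj_on_def)
  moreover have "continuous_on double_broom (e \<circ> uminus)"
    using assms unfolding broom_at_def by (intro continuous_on_compose continuous_intros) simp
  moreover have "inj_on (e \<circ> uminus) double_broom"
    using assms unfolding broom_at_def by (intro comp_inj_on) (auto simp: inj_on_def)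
  ultimately show ?thesis
    using assms unfolding broom_at_def by (simp only: image_comp[symmetric] uminus_double_broom simp_thms)
qed

lemma broom_at_homeomorphism:
  assumes "broom_at Z e"
  obtains i where "homeomorphism double_broom (e ` double_broom) e i"
  using assms homeomorphism_compact[OF compact_double_broom] unfolding broom_at_def by metis

text \<open>\<open>e\<close> is a homeomorphism onto its image, so the image of \<open>U\<close> is
  open in the broom without its center, and that set is open in \<open>Z\<close>.\<close>

lemma broom_at_open:
  assumes e: "broom_at Z e" and U: "openin (top_of_set double_broom) U" and "0 \<notin> U"
  shows "openin (top_of_set Z) (e ` U)"
proof -
  obtain i where "homeomorphism double_broom (e ` double_broom) e i"
    using broom_at_homeomorphism[OF e] .
  then have "openin (top_of_set (e ` double_broom)) (e ` U)"
    using U by (rule homeomorphism_imp_open_map)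
  moreover have "e ` U \<subseteq> e ` (double_broom - {0})"
    using openin_imp_subset[OF U] \<open>0 \<notin> U\<close> by auto
  ultimately have "openin (top_of_set (e ` (double_broom - {0}))) (e ` U)"
    by (rule openin_subset_trans) auto
  then show ?thesis
    using e unfolding broom_at_def by (meson openin_trans)
qed

lemma compact_broom_image:
  assumes "broom_at Z e" "C \<subseteq> double_broom" "compact C"
  shows "compact (e ` C)"
  using assms unfolding broom_at_def by (meson compact_continuous_image continuous_on_subset)

text \<open>The hair is open in \<open>Z\<close> and becomes compact when the apex is added; hence
  its intersection with \<open>C\<close> is clopen in \<open>C\<close>.\<close>

lemma connected_in_hair:
  assumes e: "broom_at Z e" and C: "connected C" "C \<subseteq> Z" and n: "n \<ge> 1"
    and apex: "e (0, 1) \<notin> C" and meet: "C \<inter> e ` hair n \<noteq> {}"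
  shows "C \<subseteq> e ` hair n"
proof -
  have sub: "insert (0, 1) (hair n) \<subseteq> double_broom"
    using hair_subset_upper[OF n] upper_subset_double by auto
  have "openin (top_of_set Z) (e ` hair n)"
    using e open_hair[OF n] hair_subset_upper[OF n] by (intro broom_at_open) auto
  then obtain T where T: "open T" "e ` hair n = Z \<inter> T"
    by (auto simp: openin_open)
  then have "C \<inter> e ` hair n = C \<inter> T" using C(2) by auto
  then have 1: "openin (top_of_set C) (C \<inter> e ` hair n)"
    using T(1) by (auto simp: openin_open)
  have "compact (e ` insert (0, 1) (hair n))"
    using compact_broom_image[OF e sub compact_hair] .
  then have "closedin (top_of_set C) (C \<inter> e ` insert (0, 1) (hair n))"
    by (simp add: closedin_closed_Int compact_imp_closed)
  moreover have "C \<inter> e ` insert (0, 1) (hair n) = C \<inter> e ` hair n"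
    using apex by auto
  ultimately have "closedin (top_of_set C) (C \<inter> e ` hair n)" by simp
  with 1 C(1) have "C \<inter> e ` hair n = {} \<or> C \<inter> e ` hair n = C"
    unfolding connected_clopen by blast
  then show ?thesis using meet by auto
qed

section \<open>Homotopies near the center of a broom\<close>

lemma broom_at_apex:
  assumes "broom_at Z e" shows "e (0, 1) \<noteq> e 0"
proof
  assume "e (0, 1) = e 0"
  then have "(0, 1) = (0 :: real \<times> real)"
    using assms inj_onD[of e double_broom "(0, 1)" 0] unfolding broom_at_def by auto
  then show False by (simp add: zero_prod_def)
qed

lemma center_limit:
  assumes "broom_at Z e" shows "(\<lambda>n. e (1 / real n, 0)) \<longlonglongrightarrow> e 0"
proof -
  have "(\<lambda>n. (1 / real n, 0 :: real)) \<longlonglongrightarrow> (0, 0)"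
    by (intro tendsto_Pair lim_1_over_n tendsto_const)
  moreover have "\<forall>\<^sub>F n in sequentially. (1 / real n, 0) \<in> double_broom"
    using eventually_ge_at_top[of 1]
    by eventually_elim (use base_point_in_hair hair_subset_upper upper_subset_double in blast)
  ultimately show ?thesis
    using assms unfolding broom_at_def zero_prod_def[symmetric]
    by (intro continuous_on_tendsto_compose[of double_broom e]) auto
qed

text \<open>As long as the center stays within half the distance to the apex, uniform continuity
  keeps the trajectories of nearby feet away from the apex; being connected, they remain in their
  own hairs. In the limit the center cannot leave the closed half broom.\<close>

lemma homotopy_tracks_hairs:
  fixes Z :: "'a::heine_borel set"
  assumes e: "broom_at Z e" and W: "openin (top_of_set Z) W" "e 0 \<in> W"
    and h: "continuous_on ({0..1::real} \<times> W) h" "h \<in> {0..1} \<times> W \<rightarrow> Z" "\<And>w. w \<in> W \<Longrightarrow> h (0, w) = w"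
    and \<tau>: "0 \<le> \<tau>" "\<tau> \<le> 1"
    and near: "\<And>s. \<lbrakk>0 \<le> s; s \<le> \<tau>\<rbrakk> \<Longrightarrow> dist (h (s, e 0)) (e 0) < dist (e (0, 1)) (e 0) / 2"
  shows "\<forall>\<^sub>F n in sequentially. \<forall>s\<in>{0..\<tau>}. h (s, e (1 / real n, 0)) \<in> e ` hair n"
    and "\<lbrakk>0 \<le> s; s \<le> \<tau>\<rbrakk> \<Longrightarrow> h (s, e 0) \<in> e ` upper_broom"
proof -
  define u where "u = (\<lambda>n. e (1 / real n, 0))"
  have u_lim: "u \<longlonglongrightarrow> e 0" using center_limit[OF e] by (simp add: u_def)
  have hair_sub: "hair n \<subseteq> double_broom" if "n \<ge> 1" for n
    using hair_subset_upper[OF that] upper_subset_double by auto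
  have uZ: "\<forall>\<^sub>F n in sequentially. u n \<in> Z"
    using eventually_ge_at_top[of 1]
    by eventually_elim (use base_point_in_hair hair_sub e in \<open>unfold u_def broom_at_def; blast\<close>)
  obtain T where T: "open T" "W = Z \<inter> T" using W by (auto simp: openin_open)
  have "\<forall>\<^sub>F n in sequentially. u n \<in> T"
    using u_lim T W by (auto elim: topological_tendstoD)
  with uZ have uW: "\<forall>\<^sub>F n in sequentially. u n \<in> W" by eventually_elim (simp add: T)
  then obtain N where N: "\<And>n. n \<ge> N \<Longrightarrow> u n \<in> W" by (auto simp: eventually_sequentially)
  \<comment> \<open>The feet together with their limit form a compact set, on which \<open>h\<close>
    is uniformly continuous in space and time; the shift by \<open>N\<close> keeps it inside
    \<open>W\<close>.\<close>
  define K where "K = insert (e 0) (range (\<lambda>n. u (n + N)))"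
  have K: "compact K" "K \<subseteq> W"
    unfolding K_def using u_lim N W by (auto intro!: compact_sequence_with_limit LIMSEQ_ignore_initial_segment)
  have hK: "continuous_on ({0..1} \<times> K) h" using K h(1) by (auto intro: continuous_on_subset)
  then have unif: "uniformly_continuous_on ({0..1} \<times> K) h"
    using K by (intro compact_uniformly_continuous compact_Times) auto
  note apex = broom_at_apex[OF e]
  \<comment> \<open>Two errors below \<open>r\<close> add up to less than the distance from the
    center to the apex.\<close>
  define r where "r = dist (e (0, 1)) (e 0) / 2"
  have "r > 0" using apex by (simp add: r_def)
  then obtain d where "d > 0"
    and d: "\<And>x x'. \<lbrakk>x \<in> {0..1} \<times> K; x' \<in> {0..1} \<times> K; dist x' x < d\<rbrakk> \<Longrightarrow> dist (h x') (h x) < r"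
    using unif unfolding uniformly_continuous_on_def by metis
  have "\<forall>\<^sub>F n in sequentially. dist (u n) (e 0) < d"
    using u_lim \<open>d > 0\<close> by (rule tendstoD)
  then have "\<forall>\<^sub>F n in sequentially. n \<ge> 1 \<and> n \<ge> N \<and> dist (u n) (e 0) < d"
    using eventually_ge_at_top[of 1] eventually_ge_at_top[of N] by eventually_elim simp
  then show *: "\<forall>\<^sub>F n in sequentially. \<forall>s\<in>{0..\<tau>}. h (s, u n) \<in> e ` hair n"
  proof eventually_elim
    case (elim n)
    have unK: "u n \<in> K"
      using elim by (auto simp: K_def intro!: range_eqI[of _ _ "n - N"])
    let ?C = "(\<lambda>s. h (s, u n)) ` {0..\<tau>}"
    have "continuous_on {0..\<tau>} (\<lambda>s. h (s, u n))"
      using unK K \<tau> by (intro continuous_on_compose2[OF hK]) (auto intro!: continuous_intros)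
    then have "connected ?C" by (intro connected_continuous_image) auto
    moreover have "?C \<subseteq> Z"
      using h(2) \<tau> unK K by auto
    moreover have "e (0, 1) \<notin> ?C"
    proof
      assume "e (0, 1) \<in> ?C"
      then obtain s where s: "0 \<le> s" "s \<le> \<tau>" "e (0, 1) = h (s, u n)" by auto
      have "dist (h (s, u n)) (h (s, e 0)) < r"
        using d[of "(s, e 0)" "(s, u n)"] s \<tau> unK elim by (auto simp: dist_Pair_Pair K_def)
      moreover have "dist (h (s, e 0)) (e 0) < r" using near s by (simp add: r_def)
      ultimately have "dist (h (s, u n)) (e 0) < r + r"
        using dist_triangle[of "h (s, u n)" "e 0" "h (s, e 0)"] by linarith
      then show False using s(3) by (simp add: r_def)
    qed
    moreover have "?C \<inter> e ` hair n \<noteq> {}"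
    proof -
      have "h (0, u n) = u n" using h(3) unK K by auto
      moreover have "u n \<in> e ` hair n" unfolding u_def using base_point_in_hair by blast
      moreover have "h (0, u n) \<in> ?C" using \<tau> by auto
      ultimately show ?thesis by auto
    qed
    ultimately have "?C \<subseteq> e ` hair n"
      using connected_in_hair[OF e] elim by blast
    then show ?case by auto
  qed
  assume s: "0 \<le> s" "s \<le> \<tau>"
  show "h (s, e 0) \<in> e ` upper_broom"
  proof (rule Lim_in_closed_set[OF _ _ trivial_limit_sequentially])
    show "closed (e ` upper_broom)"
      using compact_broom_image[OF e upper_subset_double compact_upper_broom] by (rule compact_imp_closed)
    show "\<forall>\<^sub>F n in sequentially. h (s, u n) \<in> e ` upper_broom"
      using * eventually_ge_at_top[of 1]
    proof eventually_elim
      case (elim n)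
      then have "h (s, u n) \<in> e ` hair n" using s by auto
      then show ?case using hair_subset_upper[OF elim(2)] by blast
    qed
    show "(\<lambda>n. h (s, u n)) \<longlonglongrightarrow> h (s, e 0)"
      using uW s \<tau> W by (intro continuous_on_tendsto_compose[OF h(1)] tendsto_Pair u_lim tendsto_const) auto
  qed
qed

text \<open>Tracking the hairs of both halves confines the center to the intersection of the halves,
  which is the center itself, so it never starts to move. The second conclusion, that nearby feet
  end in their own hairs, is what tells \<open>k\<close> apart from a constant map.\<close>

lemma homotopy_fixes_center:
  fixes Z :: "'a::heine_borel set"
  assumes e: "broom_at Z e" and W: "openin (top_of_set Z) W" "e 0 \<in> W"
    and hom: "homotopic_with_canon (\<lambda>_. True) W Z id k"
  shows "k (e 0) = e 0" and "\<forall>\<^sub>F n in sequentially. k (e (1 / real n, 0)) \<in> e ` hair n"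
proof -
  obtain h where h: "continuous_on ({0..1::real} \<times> W) h" "h \<in> {0..1} \<times> W \<rightarrow> Z"
    "\<And>w. h (0, w) = w" "\<And>w. h (1, w) = k w"
    using hom unfolding homotopic_with_def by (auto simp: image_subset_iff_funcset)
  note e' = broom_at_uminus[OF e]
  have W': "(e \<circ> uminus) 0 \<in> W" using W by simp
  have apex: "e (0, 1) \<noteq> e 0" "e (0, -1) \<noteq> e 0"
    using broom_at_apex[OF e] broom_at_apex[OF e'] by simp_all
  \<comment> \<open>Small enough for the apices of both halves.\<close>
  define r where "r = min (dist (e (0, 1)) (e 0)) (dist (e (0, -1)) (e 0)) / 2"
  have r: "r > 0" "r \<le> dist (e (0, 1)) (e 0) / 2" "r \<le> dist (e (0, -1)) (e 0) / 2"
    using apex by (auto simp: r_def)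
  have stay: "h (s, e 0) = e 0"
    if "0 \<le> s" "s \<le> 1" "\<And>s'. \<lbrakk>0 \<le> s'; s' \<le> s\<rbrakk> \<Longrightarrow> dist (h (s', e 0)) (e 0) < r" for s
  proof -
    have "dist (h (s', e 0)) (e 0) < dist (e (0, 1)) (e 0) / 2"
      "dist (h (s', e 0)) (e 0) < dist (e (0, -1)) (e 0) / 2" if "0 \<le> s'" "s' \<le> s" for s'
      using \<open>\<And>s'. \<lbrakk>0 \<le> s'; s' \<le> s\<rbrakk> \<Longrightarrow> dist (h (s', e 0)) (e 0) < r\<close>[OF that] r by linarith+
    then have "h (s, e 0) \<in> e ` upper_broom" "h (s, e 0) \<in> (e \<circ> uminus) ` upper_broom"
      using homotopy_tracks_hairs(2)[OF e W h(1,2,3), of s s]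
        homotopy_tracks_hairs(2)[OF e' W(1) W' h(1,2,3), of s s] that by auto
    then have "h (s, e 0) \<in> e ` upper_broom \<inter> e ` uminus ` upper_broom" by (auto simp: image_comp)
    also have "\<dots> = e ` (upper_broom \<inter> uminus ` upper_broom)"
      using e by (intro inj_on_image_Int[symmetric, of _ double_broom]) (auto simp: broom_at_def double_broom_eq)
    finally show ?thesis by (simp add: upper_broom_Int_lower)
  qed
  have cont: "continuous_on {0..1} (\<lambda>s. dist (h (s, e 0)) (e 0))"
    using W by (intro continuous_intros continuous_on_compose2[OF h(1)]) auto
  have all: "h (s, e 0) = e 0" if s: "0 \<le> s" "s \<le> 1" for s
  proof (rule ccontr)
    let ?\<phi> = "\<lambda>s. dist (h (s, e 0)) (e 0)"
    assume "h (s, e 0) \<noteq> e 0"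
    \<comment> \<open>If the center moved, its distance from the start would attain the level
      \<open>c\<close>, chosen below \<open>r\<close>. The first time \<open>t\<close> at which this
      happens will contradict \<open>stay\<close>.\<close>
    define c where "c = min (?\<phi> s) (r / 2)"
    have c: "0 < c" "c \<le> ?\<phi> s" "c < r" using r \<open>h (s, e 0) \<noteq> e 0\<close> by (auto simp: c_def)
    let ?S = "{0..s} \<inter> ?\<phi> -` {c}"
    have conts: "continuous_on {0..t} ?\<phi>" if "t \<le> s" for t
      using cont that s by (auto intro: continuous_on_subset)
    have "compact ?S"
      by (rule closedin_compact[OF _ continuous_closedin_preimage[OF conts]]) auto
    moreover have "?S \<noteq> {}"
      using IVT'[of ?\<phi> 0 c s] c s conts[of s] h(3) by auto
    ultimately obtain t where t: "t \<in> ?S" "\<And>t'. t' \<in> ?S \<Longrightarrow> t \<le> t'"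
      by (metis compact_attains_inf)
    \<comment> \<open>Reaching \<open>r\<close> requires passing \<open>c\<close> first, and
      \<open>t\<close> is the first time at level \<open>c\<close>.\<close>
    have "?\<phi> t' < r" if t': "0 \<le> t'" "t' \<le> t" for t'
    proof (rule ccontr)
      assume "\<not> ?\<phi> t' < r"
      then obtain t'' where "0 \<le> t''" "t'' \<le> t'" "?\<phi> t'' = c"
        using IVT'[of ?\<phi> 0 c t'] c t t' h(3) conts[of t'] by auto
      then have "t \<le> t''" using t t' by auto
      then have "t' = t" using \<open>t'' \<le> t'\<close> t' by simp
      then show False using \<open>\<not> ?\<phi> t' < r\<close> t(1) c by auto
    qed
    then have "h (t, e 0) = e 0" using t s by (intro stay) auto
    then show False using t c by auto
  qed
  from all[of 1] show "k (e 0) = e 0" by (simp add: h)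
  have "dist (h (s, e 0)) (e 0) < dist (e (0, 1)) (e 0) / 2" if "0 \<le> s" "s \<le> 1" for s
    using all[OF that] apex by simp
  from homotopy_tracks_hairs(1)[OF e W h(1,2,3), of 1, OF _ _ this]
  have "\<forall>\<^sub>F n in sequentially. \<forall>s\<in>{0..1}. h (s, e (1 / real n, 0)) \<in> e ` hair n" by simp
  then show "\<forall>\<^sub>F n in sequentially. k (e (1 / real n, 0)) \<in> e ` hair n"
    by eventually_elim (auto simp: h(4)[symmetric])
qed

lemma center_not_in_hair:
  assumes "broom_at Z e" "n \<ge> 1" shows "e 0 \<notin> e ` hair n"
  using assms hair_subset_upper[of n] upper_subset_double unfolding broom_at_def
  by (auto dest!: inj_onD[of e double_broom 0])

text \<open>The constant would have to be \<open>e 0\<close>, because the center is fixed, and would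
  also have to lie in a hair, because nearby feet stay in their hairs; but no hair contains the
  center.\<close>

lemma no_nullhomotopic_neighbourhood:
  fixes Z :: "'a::heine_borel set"
  assumes e: "broom_at Z e" and W: "openin (top_of_set Z) W" "e 0 \<in> W"
  shows "\<not> homotopic_with_canon (\<lambda>_. True) W Z id (\<lambda>_. c)"
proof
  assume "homotopic_with_canon (\<lambda>_. True) W Z id (\<lambda>_. c)"
  from homotopy_fixes_center[OF e W this]
  have "c = e 0" "\<forall>\<^sub>F n in sequentially. c \<in> e ` hair n" by auto
  then have "\<forall>\<^sub>F n in sequentially. e 0 \<in> e ` hair n" by simp
  then have "\<forall>\<^sub>F n::nat in sequentially. False"
    using eventually_ge_at_top[of 1] by eventually_elim (use center_not_in_hair[OF e] in auto)
  then show False by simp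
qed

text \<open>On the preimage of \<open>U\<close> under \<open>g\<close> the identity is homotopic to
  \<open>f \<circ> g\<close>, and the contraction of \<open>U\<close> makes this map homotopic to a
  constant, although the center of a broom has no such neighbourhood.\<close>

lemma right_inverse_no_nullhomotopic_neighbourhood:
  fixes Z :: "'a::heine_borel set" and X :: "'b::heine_borel set"
  assumes e: "broom_at Z e"
    and f: "continuous_on X f" "f \<in> X \<rightarrow> Z" and g: "continuous_on Z g" "g \<in> Z \<rightarrow> X"
    and fg: "homotopic_with_canon (\<lambda>_. True) Z Z (f \<circ> g) id"
    and U: "openin (top_of_set X) U" "g (e 0) \<in> U"
    and null: "homotopic_with_canon (\<lambda>_. True) U X id (\<lambda>_. c)"
  shows False
proof -
  have eZ: "e 0 \<in> Z" using e by (auto simp: broom_at_def)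
  define W where "W = Z \<inter> g -` U"
  have W: "openin (top_of_set Z) W" "e 0 \<in> W"
    using continuous_openin_preimage[OF g U(1)] U(2) eZ by (auto simp: W_def)
  have "W \<subseteq> Z" by (auto simp: W_def)
  have "homotopic_with_canon (\<lambda>_. True) W Z id (f \<circ> g)"
    using fg \<open>W \<subseteq> Z\<close> homotopic_with_subset_left homotopic_with_symD by blast
  moreover have "homotopic_with_canon (\<lambda>_. True) W Z (f \<circ> (id \<circ> g)) (f \<circ> ((\<lambda>_. c) \<circ> g))"
    using f g \<open>W \<subseteq> Z\<close> null
    by (intro homotopic_with_compose_continuous_left[of _ _ W X] homotopic_with_compose_continuous_right[of _ _ U])
      (auto simp: W_def intro: continuous_on_subset)
  ultimately have "homotopic_with_canon (\<lambda>_. True) W Z id (f \<circ> ((\<lambda>_. c) \<circ> g))"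
    by (simp add: homotopic_with_trans)
  then have "homotopic_with_canon (\<lambda>_. True) W Z id (\<lambda>_. f c)" by (simp add: o_def)
  then show False using no_nullhomotopic_neighbourhood[OF e W] by blast
qed

text \<open>A connected neighbourhood \<open>V\<close> of \<open>g (e 0)\<close> which
  \<open>f\<close> keeps off the apex also contains the images of feet close to the center. Its
  image under \<open>f\<close> is connected and meets a hair, hence lies in it, yet it contains the
  center.\<close>

lemma right_inverse_no_small_connected_neighbourhoods:
  fixes Z :: "'a::heine_borel set" and X :: "'b::heine_borel set"
  assumes e: "broom_at Z e"
    and f: "continuous_on X f" "f \<in> X \<rightarrow> Z" and g: "continuous_on Z g" "g \<in> Z \<rightarrow> X"
    and fg: "homotopic_with_canon (\<lambda>_. True) Z Z (f \<circ> g) id"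
    and small: "\<And>U. \<lbrakk>openin (top_of_set X) U; g (e 0) \<in> U\<rbrakk> \<Longrightarrow>
      \<exists>V\<subseteq>U. openin (top_of_set X) V \<and> g (e 0) \<in> V \<and> connected V"
  shows False
proof -
  have eZ: "e 0 \<in> Z" using e by (auto simp: broom_at_def)
  note apex = broom_at_apex[OF e]
  note fixed = homotopy_fixes_center[OF e openin_subtopology_self eZ homotopic_with_symD[OF fg]]
  define U where "U = X \<inter> f -` (- {e (0, 1)})"
  have "openin (top_of_set X) U" unfolding U_def
    using f by (intro continuous_openin_preimage_gen) auto
  moreover have "g (e 0) \<in> U" using fixed(1) apex g eZ by (auto simp: U_def)
  ultimately obtain V where V: "V \<subseteq> U" "openin (top_of_set X) V" "g (e 0) \<in> V" "connected V"
    using small by blast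
  have VX: "V \<subseteq> X" using V by (auto simp: U_def)
  have "openin (top_of_set Z) (Z \<inter> g -` V)"
    by (rule continuous_openin_preimage[OF g V(2)])
  then obtain T where T: "open T" "Z \<inter> g -` V = Z \<inter> T" by (auto simp: openin_open)
  have "e 0 \<in> T" using T V(3) eZ by blast
  then have "\<forall>\<^sub>F n in sequentially. e (1 / real n, 0) \<in> T"
    using topological_tendstoD[OF center_limit[OF e] T(1)] by blast
  then have "\<forall>\<^sub>F n in sequentially. n \<ge> 1 \<and> e (1 / real n, 0) \<in> T \<and> (f \<circ> g) (e (1 / real n, 0)) \<in> e ` hair n"
    using fixed(2) eventually_ge_at_top[of 1] by eventually_elim simp
  then obtain n where n: "n \<ge> 1" "e (1 / real n, 0) \<in> T" "f (g (e (1 / real n, 0))) \<in> e ` hair n"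
    by (auto simp: eventually_sequentially)
  have "e (1 / real n, 0) \<in> Z"
    using n(1) base_point_in_hair[of n] hair_subset_upper[OF n(1)] upper_subset_double e
    unfolding broom_at_def by blast
  then have "g (e (1 / real n, 0)) \<in> V" using T n by blast
  have "connected (f ` V)"
    using V f VX by (intro connected_continuous_image) (auto intro: continuous_on_subset)
  then have "f ` V \<subseteq> e ` hair n"
    using \<open>g (e (1 / real n, 0)) \<in> V\<close> n(3) f VX V(1) n(1)
    by (intro connected_in_hair[OF e]) (auto simp: U_def)
  moreover have "e 0 \<in> f ` V" using fixed(1) V(3) by force
  ultimately show False using center_not_in_hair[OF e n(1)] by auto
qed

section \<open>Injective arcs through the center of a broom\<close>

lemma no_injective_arc_at_minimum:
  fixes p :: "real \<Rightarrow> real"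
  assumes "continuous_on {-a..a} p" "inj_on p {-a..a}" "0 < a" "\<And>t. \<lbrakk>-a \<le> t; t \<le> a\<rbrakk> \<Longrightarrow> p 0 \<le> p t"
  shows False
  using continuous_inj_imp_mono[of "-a" 0 a p] assms(4)[of a] assms(4)[of "-a"] assms(1-3) by auto

text \<open>Near the center the arc misses the apex, so it cannot meet a hair: it would lie entirely
  in that hair, which does not contain the center. It therefore stays on the handle, where the
  height would be injective along the arc with an interior minimum at time 0.\<close>

lemma no_injective_arc_in_half_broom:
  fixes q :: "real \<Rightarrow> 'a::heine_borel"
  assumes e: "broom_at Z e" and q: "continuous_on UNIV q" "q 0 = e 0"
    and inj: "inj_on q {-a..a}" "0 < a" and sub: "q ` {-a..a} \<subseteq> e ` upper_broom"
  shows False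
proof -
  obtain i where i: "homeomorphism double_broom (e ` double_broom) e i"
    using broom_at_homeomorphism[OF e] .
  note apex = broom_at_apex[OF e]
  have "open (q -` (- {e (0, 1)}))"
    using q(1) by (intro open_vimage) auto
  moreover have "0 \<in> q -` (- {e (0, 1)})" using q apex by auto
  ultimately obtain d where d: "d > 0" "\<And>t. \<bar>t\<bar> < d \<Longrightarrow> q t \<noteq> e (0, 1)"
    unfolding open_dist dist_norm by (metis ComplD diff_zero insertI1 real_norm_def vimage_eq)
  define b where "b = min a (d / 2)"
  have b: "0 < b" "b \<le> a" "b < d" using d inj(2) by (auto simp: b_def)
  have sub_b: "q ` {-b..b} \<subseteq> e ` upper_broom" using sub b by force
  have conn: "connected (q ` {-b..b})"
    using q by (intro connected_continuous_image) (auto intro: continuous_on_subset)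
  have "q ` {-b..b} \<inter> e ` hair n = {}" if "n \<ge> 1" for n
  proof (rule ccontr)
    assume "q ` {-b..b} \<inter> e ` hair n \<noteq> {}"
    moreover have "e (0, 1) \<notin> q ` {-b..b}" using d(2) b by force
    moreover have "q ` {-b..b} \<subseteq> Z"
      using sub_b e upper_subset_double unfolding broom_at_def by blast
    ultimately have "q ` {-b..b} \<subseteq> e ` hair n"
      using connected_in_hair[OF e conn _ that] by blast
    moreover have "q 0 \<in> q ` {-b..b}" using b by auto
    ultimately show False using center_not_in_hair[OF e that] q by auto
  qed
  note no_hair = this
  have handle: "\<exists>y\<ge>0. q t = e (0, y) \<and> (0, y) \<in> double_broom" if t: "-b \<le> t" "t \<le> b" for t
  proof -
    obtain p where p: "p \<in> upper_broom" "q t = e p" using sub_b t by force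
    moreover have "q t \<in> q ` {-b..b}" using t by auto
    ultimately have "p \<notin> hair n" if "n \<ge> 1" for n
      using no_hair[OF that] by auto
    then have "fst p = 0" "0 \<le> snd p" using upper_broom_cases[OF p(1)] by metis+
    then have "p = (0, snd p)" by (simp add: prod_eq_iff)
    then show ?thesis using p \<open>0 \<le> snd p\<close> upper_subset_double by (metis subset_iff)
  qed
  have ie: "i (e p) = p" if "p \<in> double_broom" for p
    using i that by (auto simp: homeomorphism_def)
  show False
  proof (rule no_injective_arc_at_minimum[of b "snd \<circ> i \<circ> q"])
    show "continuous_on {-b..b} (snd \<circ> i \<circ> q)"
    proof (intro continuous_on_compose)
      show "continuous_on {-b..b} q" using q(1) by (rule continuous_on_subset) simp
      have "q ` {-b..b} \<subseteq> e ` double_broom" using sub_b upper_subset_double by blast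
      then show "continuous_on (q ` {-b..b}) i"
        by (rule continuous_on_subset[OF homeomorphism_cont2[OF i]])
    qed (intro continuous_intros)
    show "inj_on (snd \<circ> i \<circ> q) {-b..b}"
    proof (rule inj_onI)
      fix s t assume st: "s \<in> {-b..b}" "t \<in> {-b..b}" "(snd \<circ> i \<circ> q) s = (snd \<circ> i \<circ> q) t"
      then have "q s = q t" using handle[of s] handle[of t] by (auto simp: ie)
      then show "s = t" using inj st b by (auto dest: inj_onD)
    qed
    show "(snd \<circ> i \<circ> q) 0 \<le> (snd \<circ> i \<circ> q) t" if "-b \<le> t" "t \<le> b" for t
      using handle[OF that] q(2) by (auto simp: ie)
  qed (use b in auto)
qed

text \<open>Openness holds because the other half is compact. The contraction is linear towards the
  apex, carried over to \<open>Z\<close> by \<open>e\<close>; it is defined on the whole half broom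
  and then restricted.\<close>

lemma half_broom_nullhomotopic:
  fixes Z :: "'a::euclidean_space set"
  assumes e: "broom_at Z e"
  shows "openin (top_of_set Z) (e ` (upper_broom - {0}))"
    and "homotopic_with_canon (\<lambda>_. True) (e ` (upper_broom - {0})) Z id (\<lambda>_. e (0, 1))"
proof -
  have "compact (uminus ` upper_broom)"
    by (intro compact_continuous_image compact_upper_broom continuous_intros)
  then have "openin (top_of_set double_broom) (double_broom \<inter> - (uminus ` upper_broom))"
    by (intro openin_open_Int) (simp add: compact_imp_closed open_closed)
  moreover have "double_broom \<inter> - (uminus ` upper_broom) = upper_broom - {0}"
    using upper_broom_Int_lower by (auto simp: double_broom_eq)
  ultimately show "openin (top_of_set Z) (e ` (upper_broom - {0}))"
    using broom_at_open[OF e] by simp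
  obtain i where i: "homeomorphism double_broom (e ` double_broom) e i"
    using broom_at_homeomorphism[OF e] .
  have ie: "i (e p) = p" if "p \<in> upper_broom" for p
    using i that upper_subset_double by (auto simp: homeomorphism_def)
  have cone: "homotopic_with_canon (\<lambda>_. True) upper_broom upper_broom id (\<lambda>_. (0, 1))"
    by (intro homotopic_with_linear) (use starlike_upper in \<open>auto intro!: continuous_intros\<close>)
  have "homotopic_with_canon (\<lambda>_. True) (e ` upper_broom) Z (e \<circ> (id \<circ> i)) (e \<circ> ((\<lambda>_. (0, 1)) \<circ> i))"
  proof (rule homotopic_with_compose_continuous_left)
    show "homotopic_with_canon (\<lambda>_. True) (e ` upper_broom) upper_broom (id \<circ> i) ((\<lambda>_. (0, 1)) \<circ> i)"
    proof (rule homotopic_with_compose_continuous_right[OF cone])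
      show "continuous_on (e ` upper_broom) i"
        using i upper_subset_double
        by (intro continuous_on_subset[OF homeomorphism_cont2[OF i]]) auto
    qed (use ie in auto)
    show "continuous_on upper_broom e" "e \<in> upper_broom \<rightarrow> Z"
      using e upper_subset_double unfolding broom_at_def by (auto intro: continuous_on_subset)
  qed
  then have "homotopic_with_canon (\<lambda>_. True) (e ` (upper_broom - {0})) Z (e \<circ> (id \<circ> i)) (e \<circ> ((\<lambda>_. (0, 1)) \<circ> i))"
    by (rule homotopic_with_subset_left) auto
  then show "homotopic_with_canon (\<lambda>_. True) (e ` (upper_broom - {0})) Z id (\<lambda>_. e (0, 1))"
    by (rule homotopic_with_eq) (auto simp: ie)
qed

text \<open>Open sets covering \<open>C\<close> also cover a uniform neighbourhood of
  \<open>C\<close>, which contains all but finitely many \<open>K i\<close>, since these meet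
  \<open>C\<close> and shrink. The lemma serves for brooms on a disk and for hairy disks on the
  axis; the index set \<open>J\<close> allows single pieces to be left out.\<close>

lemma compact_Un_shrinking:
  fixes K :: "nat \<Rightarrow> 'a::metric_space set"
  assumes C: "compact C" and K: "\<And>i. i \<in> J \<Longrightarrow> compact (K i)"
    and meet: "\<And>i. i \<in> J \<Longrightarrow> K i \<inter> C \<noteq> {}"
    and diam: "(\<lambda>i. diameter (K i)) \<longlonglongrightarrow> 0"
  shows "compact (C \<union> (\<Union>i\<in>J. K i))"
proof (rule compactI)
  let ?S = "C \<union> (\<Union>i\<in>J. K i)"
  fix \<C> assume \<C>: "\<forall>t\<in>\<C>. open t" "?S \<subseteq> \<Union>\<C>"
  obtain \<D> where \<D>: "\<D> \<subseteq> \<C>" "finite \<D>" "C \<subseteq> \<Union>\<D>"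
    using compactE[OF C, of \<C>] \<C> by auto
  have "open (\<Union>\<D>)" using \<D> \<C> by auto
  then obtain \<epsilon> where \<epsilon>: "\<epsilon> > 0" "(\<Union>x\<in>C. ball x \<epsilon>) \<subseteq> \<Union>\<D>"
    using compact_subset_open_imp_ball_epsilon_subset[OF C _ \<D>(3)] by blast
  have "\<forall>\<^sub>F i in sequentially. diameter (K i) < \<epsilon>"
    using diam \<epsilon>(1) by (rule order_tendstoD)
  then obtain N where N: "\<And>i. i \<ge> N \<Longrightarrow> diameter (K i) < \<epsilon>"
    by (auto simp: eventually_sequentially)
  have far: "K i \<subseteq> \<Union>\<D>" if i: "i \<in> J" "i \<ge> N" for i
  proof
    fix x assume x: "x \<in> K i"
    obtain c where c: "c \<in> K i" "c \<in> C" using meet i by blast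
    have "dist c x \<le> diameter (K i)"
      using diameter_bounded_bound[OF compact_imp_bounded[OF K[OF i(1)]] c(1) x] .
    then have "x \<in> ball c \<epsilon>" using N[OF i(2)] by simp
    then show "x \<in> \<Union>\<D>" using c \<epsilon>(2) by blast
  qed
  have "compact (\<Union>i\<in>J \<inter> {..<N}. K i)"
    using K by (intro compact_UN) auto
  then obtain \<E> where \<E>: "\<E> \<subseteq> \<C>" "finite \<E>" "(\<Union>i\<in>J \<inter> {..<N}. K i) \<subseteq> \<Union>\<E>"
    using \<C> by (elim compactE[of _ \<C>]) auto
  have "?S \<subseteq> \<Union>(\<D> \<union> \<E>)"
  proof
    fix x assume "x \<in> ?S"
    then show "x \<in> \<Union>(\<D> \<union> \<E>)"
    proof
      assume "x \<in> (\<Union>i\<in>J. K i)"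
      then obtain i where "i \<in> J" "x \<in> K i" by auto
      then show ?thesis using far[of i] \<E>(3) by (cases "i < N") auto
    qed (use \<D> in auto)
  qed
  then show "\<exists>C'\<subseteq>\<C>. finite C' \<and> ?S \<subseteq> \<Union>C'"
    using \<D> \<E> by (intro exI[of _ "\<D> \<union> \<E>"]) auto
qed

section \<open>The spaces\<close>

lemma connected_double_broom: "connected double_broom"
proof -
  have "connected upper_broom"
    using starlike_upper apex_in_brooms(1)
    by (intro starlike_imp_connected, unfold starlike_def) (metis closed_segment_commute)
  moreover from this have "connected (uminus ` upper_broom)"
    by (intro connected_continuous_image continuous_intros)
  ultimately show ?thesis
    unfolding double_broom_eq using upper_broom_Int_lower by (intro connected_Un) auto
qed

lemma fixed_on_closure:
  fixes \<phi> :: "'a::metric_space \<Rightarrow> 'b::metric_space"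
  assumes "continuous_on (closure S) \<phi>" "continuous_on (closure S) \<psi>" "\<And>x. x \<in> S \<Longrightarrow> \<phi> x = \<psi> x"
    and "x \<in> closure S"
  shows "\<phi> x = \<psi> x"
proof -
  have "continuous_on (closure S) (\<lambda>x. dist (\<phi> x) (\<psi> x))"
    using assms by (intro continuous_intros)
  then have "dist (\<phi> x) (\<psi> x) = 0"
    by (rule continuous_constant_on_closure) (use assms in auto)
  then show ?thesis by simp
qed

lemma connected_in_open_pieces:
  assumes "connected C" "openin (top_of_set Z) A" "openin (top_of_set Z) B" "C \<subseteq> A \<union> B" "A \<inter> B = {}"
  shows "C \<subseteq> A \<or> C \<subseteq> B"
proof -
  obtain S T where "open S" "A = Z \<inter> S" "open T" "B = Z \<inter> T"
    using assms by (auto simp: openin_open)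
  then have "C \<inter> S = {} \<or> C \<inter> T = {}"
    using connectedD[OF assms(1), of S T] assms(4,5) by blast
  then show ?thesis
    using assms(4) \<open>A = Z \<inter> S\<close> \<open>B = Z \<inter> T\<close> by blast
qed

text \<open>The origin is included, unlike in \<open>axis_arcs\<close>, to make the set compact. In
  \<open>(x, 0)\<close> the second component is the zero of the plane.\<close>

definition closed_axis :: "(real \<times> real \<times> real) set" where
  "closed_axis = (\<lambda>x. (x, 0)) ` {-1..0}"

definition extra_broom :: "real \<times> real \<Rightarrow> real \<times> real \<times> real" where
  "extra_broom p = (-1, (1/2) *\<^sub>R p)"

lemma axis_arcs_eq: "axis_arcs = closed_axis - {0}"
  unfolding axis_arcs_def closed_axis_def zero_prod_def by auto

lemma extra_broom_continuous: "continuous_on S extra_broom"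
  unfolding extra_broom_def by (intro continuous_intros)

lemma broom_copy_eq: "broom_copy = extra_broom ` double_broom"
  unfolding broom_copy_def extra_broom_def by (rule image_cong) auto

lemma compact_axis: "compact closed_axis"
  unfolding closed_axis_def by (intro compact_continuous_image) (auto intro!: continuous_intros)

section \<open>A hairy disk and its scaled copies\<close>

locale hairy_disk_data =
  fixes H :: "(real \<times> real) set" and m :: "nat \<Rightarrow> real \<times> real"
    and g :: "nat \<Rightarrow> real \<times> real \<Rightarrow> real \<times> real"
  assumes m_sphere: "range m \<subseteq> sphere 0 1"
    and m_dense: "sphere 0 1 \<subseteq> closure (range m)"
    and g_cont: "\<And>i. continuous_on double_broom (g i)"
    and g_inj: "\<And>i. inj_on (g i) double_broom"
    and g_center: "\<And>i. g i 0 = m i"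
    and g_disk: "\<And>i. g i ` double_broom \<inter> cball 0 1 = {m i}"
    and g_disjoint: "\<And>i j. i \<noteq> j \<Longrightarrow> g i ` double_broom \<inter> g j ` double_broom = {}"
    and g_diameter: "(\<lambda>i. diameter (g i ` double_broom)) \<longlonglongrightarrow> 0"
    and H_eq: "H = cball 0 1 \<union> (\<Union>i. g i ` double_broom)"
begin

text \<open>The index set is free because a single broom, without its center, is later recognized as
  open by the compactness of everything else.\<close>

lemma compact_disk_brooms: "compact (cball 0 1 \<union> (\<Union>i\<in>J. g i ` double_broom))"
  using g_cont g_disk g_diameter
  by (intro compact_Un_shrinking compact_continuous_image compact_double_broom) auto

lemma compact_H: "compact H"
  unfolding H_eq by (rule compact_disk_brooms)

lemma disk_subset_H: "cball 0 1 \<subseteq> H"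
  by (auto simp: H_eq)

lemma zero_in_H [simp]: "0 \<in> H"
  using disk_subset_H by auto

lemma broom_subset_H: "g i ` double_broom \<subseteq> H"
  by (auto simp: H_eq)

lemma diameter_H_pos: "0 < diameter H"
proof -
  have "(1, 0) \<in> H" using disk_subset_H by auto
  then have "dist (1, 0) (0 :: real \<times> real) \<le> diameter H"
    by (intro diameter_bounded_bound[OF compact_imp_bounded[OF compact_H]] zero_in_H)
  then show ?thesis by simp
qed

lemma norm_le_diameter_H: "p \<in> H \<Longrightarrow> norm p \<le> diameter H"
  using diameter_bounded_bound[OF compact_imp_bounded[OF compact_H], of p 0] by simp

lemma norm_broom_gt_1:
  assumes "p \<in> double_broom" "p \<noteq> 0" shows "norm (g i p) > 1"
proof (rule ccontr)
  assume "\<not> norm (g i p) > 1"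
  then have "g i p \<in> g i ` double_broom \<inter> cball 0 1" using assms by auto
  then have "g i p = g i 0" using g_disk[of i] g_center[of i] by auto
  then show False using inj_onD[OF g_inj[of i] _ assms(1)] assms by auto
qed

lemma norm_m [simp]: "norm (m i) = 1"
  using subsetD[OF m_sphere, of "m i"] by simp

lemma connected_H: "connected H"
proof -
  have "connected (g i ` double_broom)" for i
    by (intro connected_continuous_image g_cont connected_double_broom)
  then have "connected (cball 0 1 \<union> g i ` double_broom)" for i
    using g_disk[of i] by (intro connected_Un convex_connected[OF convex_cball]) auto
  then have "connected (\<Union> (range (\<lambda>i. cball 0 1 \<union> g i ` double_broom)))"
    by (intro connected_Union) auto
  moreover have "\<Union> (range (\<lambda>i. cball 0 1 \<union> g i ` double_broom)) = H"
    unfolding H_eq by auto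
  ultimately show ?thesis by simp
qed

text \<open>For \<open>k \<ge> 1\<close> this is the similarity onto the plane
  \<open>x = -1/k\<close> that gives the image of \<open>H\<close> diameter
  \<open>1/k\<close>.\<close>

definition plane :: "nat \<Rightarrow> real \<times> real \<Rightarrow> real \<times> real \<times> real" where
  "plane k p = (- 1 / real k, (1 / (real k * diameter H)) *\<^sub>R p)"

lemma hcopy_eq: "hcopy H k = plane k ` H"
  unfolding hcopy_def plane_def by (rule image_cong) auto

lemma fst_plane [simp]: "fst (plane k p) = - 1 / real k"
  by (simp add: plane_def)

lemma plane_continuous: "continuous_on S (plane k)"
  unfolding plane_def by (intro continuous_intros)

lemma plane_zero: "plane k 0 = (- 1 / real k, 0)"
  by (simp add: plane_def)

lemma plane_eq_iff: "k \<ge> 1 \<Longrightarrow> plane k p = plane k q \<longleftrightarrow> p = q"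
  using diameter_H_pos by (auto simp: plane_def)

lemma inj_plane: "k \<ge> 1 \<Longrightarrow> inj_on (plane k) S"
  by (simp add: inj_on_def plane_eq_iff)

lemma plane_cross: "\<lbrakk>k \<ge> 1; j \<ge> 1; plane k p = plane j q\<rbrakk> \<Longrightarrow> k = j \<and> p = q"
  using plane_eq_iff by (metis fst_plane minus_divide_left neg_equal_iff_equal divide_inverse mult_1
      inverse_eq_iff_eq of_nat_eq_iff)

lemma plane_in_axis: "\<lbrakk>k \<ge> 1; plane k p \<in> closed_axis\<rbrakk> \<Longrightarrow> p = 0"
  using diameter_H_pos by (auto simp: plane_def closed_axis_def)

lemma center_in_axis: "k \<ge> 1 \<Longrightarrow> plane k 0 \<in> closed_axis"
  by (auto simp: plane_zero closed_axis_def)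

lemma diameter_hcopy: "(\<lambda>k. diameter (hcopy H k)) \<longlonglongrightarrow> 0"
proof (rule tendsto_sandwich[OF _ _ tendsto_const lim_1_over_n])
  \<comment> \<open>For \<open>k = 0\<close> division by zero makes \<open>plane 0\<close> constant,
    so the bound, then 0, holds there too.\<close>
  have "diameter (hcopy H k) \<le> 1 / real k" for k
  proof (rule diameter_le)
    fix x y assume "x \<in> hcopy H k" "y \<in> hcopy H k"
    then obtain p q where pq: "p \<in> H" "q \<in> H" "x = plane k p" "y = plane k q"
      by (auto simp: hcopy_eq)
    have "norm (x - y) = norm (p - q) / diameter H * (1 / real k)"
    proof -
      have "x - y = (0, (1 / (real k * diameter H)) *\<^sub>R (p - q))"
        unfolding pq plane_def by (simp add: scaleR_diff_right)
      then show ?thesis using diameter_H_pos by (simp add: norm_Pair mult.commute)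
    qed
    also have "norm (p - q) \<le> diameter H"
      using diameter_bounded_bound[OF compact_imp_bounded[OF compact_H] pq(1,2)] by (simp add: dist_norm)
    then have "norm (p - q) / diameter H * (1 / real k) \<le> 1 * (1 / real k)"
      using diameter_H_pos by (intro mult_right_mono) auto
    finally show "norm (x - y) \<le> 1 / real k" by simp
  qed auto
  then show "\<forall>\<^sub>F k in sequentially. diameter (hcopy H k) \<le> 1 / real k" by simp
  have "0 \<le> diameter (hcopy H k)" for k
    by (intro diameter_ge_0 compact_imp_bounded) (simp add: hcopy_eq compact_H compact_continuous_image plane_continuous)
  then show "\<forall>\<^sub>F k in sequentially. 0 \<le> diameter (hcopy H k)" by simp
qed

lemma compact_axis_disks:
  assumes "J \<subseteq> {1..}" shows "compact (closed_axis \<union> (\<Union>k\<in>J. hcopy H k))"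
proof (rule compact_Un_shrinking[OF compact_axis _ _ diameter_hcopy])
  fix k assume "k \<in> J"
  then have "plane k 0 \<in> hcopy H k \<inter> closed_axis"
    using center_in_axis assms by (auto simp: hcopy_eq)
  then show "hcopy H k \<inter> closed_axis \<noteq> {}" by auto
qed (simp add: hcopy_eq compact_H compact_continuous_image plane_continuous)

lemma extra_broom_in_tail:
  assumes "extra_broom p \<in> closed_axis \<union> (\<Union>k\<in>{2..}. hcopy H k)" shows "p = 0"
proof -
  have "extra_broom p \<notin> hcopy H k" if "k \<ge> 2" for k
  proof
    assume "extra_broom p \<in> hcopy H k"
    then have "-1 = - 1 / real k" by (auto simp: extra_broom_def hcopy_eq plane_def)
    then show False using that by (auto simp: field_simps)
  qed
  then show ?thesis using assms by (auto simp: closed_axis_def extra_broom_def)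
qed

lemma compact_WH: "compact (WH H)"
proof -
  have "WH H = closed_axis \<union> (\<Union>k\<in>{1..}. hcopy H k)"
    unfolding WH_def WH_o_def axis_arcs_eq by (auto simp: closed_axis_def zero_prod_def)
  then show ?thesis using compact_axis_disks[of "{1..}"] by simp
qed

lemma compact_WBH: "compact (WBH H)"
proof -
  have "WBH H = broom_copy \<union> (closed_axis \<union> (\<Union>k\<in>{2..}. hcopy H k))"
    unfolding WBH_def WBH_o_def axis_arcs_eq by (auto simp: closed_axis_def zero_prod_def)
  then show ?thesis
    using compact_axis_disks[of "{2..}"]
    by (auto simp: broom_copy_eq intro!: compact_Un compact_continuous_image extra_broom_continuous compact_double_broom)
qed

text \<open>\<open>E\<close> is empty for the spaces without the limit point and \<open>{0}\<close>
  for the compact ones, so both pairs are treated at once.\<close>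

context
  fixes E :: "(real \<times> real \<times> real) set"
  assumes E: "E \<subseteq> {0}"
begin

abbreviation "X \<equiv> WH_o H \<union> E"
abbreviation "Y \<equiv> WBH_o H \<union> E"

lemma X_subset: "X \<subseteq> closed_axis \<union> (\<Union>k\<in>{1..}. hcopy H k)"
  using E by (auto simp: WH_o_def axis_arcs_eq closed_axis_def zero_prod_def)

lemma Y_subset: "Y \<subseteq> broom_copy \<union> (closed_axis \<union> (\<Union>k\<in>{2..}. hcopy H k))"
  using E by (auto simp: WBH_o_def axis_arcs_eq closed_axis_def zero_prod_def)

lemma plane_in_X: "\<lbrakk>k \<ge> 1; p \<in> H\<rbrakk> \<Longrightarrow> plane k p \<in> X"
  by (auto simp: WH_o_def hcopy_eq)

lemma axis_in_X: "\<lbrakk>-1 \<le> x; x < 0\<rbrakk> \<Longrightarrow> (x, 0) \<in> X"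
  by (auto simp: WH_o_def axis_arcs_def zero_prod_def)

lemma X_cases:
  assumes "p \<in> X"
  obtains "p = 0" "0 \<in> E" | x where "-1 \<le> x" "x < 0" "p = (x, 0)" | k q where "k \<ge> 1" "q \<in> H" "p = plane k q"
  using assms E by (auto simp: WH_o_def axis_arcs_def hcopy_eq zero_prod_def)

text \<open>The rest of \<open>X\<close>, together with the center of the broom, lies in the compact
  set \<open>?R\<close>: the axis, the other hairy disks, and the disk with the other brooms of the
  same copy. So the broom without its center is the complement of a closed set in
  \<open>X\<close>.\<close>

lemma broom_at_X:
  assumes k: "k \<ge> 1" shows "broom_at X (plane k \<circ> g i)"
proof -
  let ?e = "plane k \<circ> g i"
  let ?R = "closed_axis \<union> (\<Union>j\<in>{1..} - {k}. hcopy H j) \<union>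
    plane k ` (cball 0 1 \<union> (\<Union>j\<in>-{i}. g j ` double_broom))"
  have sub: "?e ` double_broom \<subseteq> X"
    using plane_in_X[OF k] broom_subset_H[of i] by (intro image_subsetI) (simp only: o_apply image_subset_iff)
  have disj: "?e p \<notin> ?R" if p: "p \<in> double_broom" "p \<noteq> 0" for p
  proof -
    have n: "norm (g i p) > 1" using norm_broom_gt_1[OF p] .
    have "?e p \<notin> closed_axis" using plane_in_axis[OF k] n by fastforce
    moreover have "?e p \<notin> (\<Union>j\<in>{1..} - {k}. hcopy H j)"
    proof -
      have "?e p \<notin> hcopy H j" if "j \<ge> 1" "j \<noteq> k" for j
      proof
        assume "?e p \<in> hcopy H j"
        then obtain q where "plane k (g i p) = plane j q" by (auto simp: hcopy_eq)
        then show False using plane_cross[OF k \<open>j \<ge> 1\<close>] \<open>j \<noteq> k\<close> by blast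
      qed
      then show ?thesis by auto
    qed
    moreover have "g i p \<notin> cball 0 1" using n by auto
    moreover have "g i p \<notin> g j ` double_broom" if "j \<noteq> i" for j
      using g_disjoint[OF that] p by auto
    ultimately have "g i p \<notin> cball 0 1 \<union> (\<Union>j\<in>-{i}. g j ` double_broom)" by auto
    then have "?e p \<notin> plane k ` (cball 0 1 \<union> (\<Union>j\<in>-{i}. g j ` double_broom))"
      unfolding o_apply by (subst inj_image_mem_iff[OF inj_plane[OF k]])
    with \<open>?e p \<notin> closed_axis\<close> \<open>?e p \<notin> (\<Union>j\<in>{1..} - {k}. hcopy H j)\<close>
    show ?thesis by (simp only: Un_iff simp_thms)
  qed
  have cover: "p \<in> ?R \<or> p \<in> ?e ` (double_broom - {0})" if "p \<in> X" for p
  proof (rule ccontr)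
    assume neg: "\<not> ?thesis"
    then have "p \<in> hcopy H k" using subsetD[OF X_subset that] by auto
    then obtain q where q: "q \<in> H" "p = plane k q" by (auto simp: hcopy_eq)
    then have "q \<notin> cball 0 1 \<union> (\<Union>j\<in>-{i}. g j ` double_broom)" using neg by auto
    then obtain r where r: "r \<in> double_broom" "q = g i r" using q(1) unfolding H_eq by auto
    then have "r = 0" using neg q by auto
    then show False using r \<open>q \<notin> _\<close> by (auto simp: g_center)
  qed
  have "compact ?R"
    by (intro compact_Un[OF compact_axis_disks compact_continuous_image] plane_continuous compact_disk_brooms) auto
  then have "openin (top_of_set X) (X \<inter> - ?R)"
    by (intro openin_open_Int open_Compl compact_imp_closed)
  moreover have "X \<inter> - ?R = ?e ` (double_broom - {0})"
  proof (intro equalityI subsetI)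
    fix p assume "p \<in> X \<inter> - ?R"
    then show "p \<in> ?e ` (double_broom - {0})" using cover by (metis IntE ComplD)
  next
    fix p assume "p \<in> ?e ` (double_broom - {0})"
    then obtain q where q: "p = ?e q" "q \<in> double_broom" "q \<noteq> 0" by (elim imageE DiffE) auto
    then have "p \<in> X" using sub by blast
    moreover have "p \<notin> ?R" unfolding q(1) by (rule disj[OF q(2,3)])
    ultimately show "p \<in> X \<inter> - ?R" by (simp only: Int_iff Compl_iff simp_thms)
  qed
  moreover have "continuous_on double_broom ?e"
    by (intro continuous_on_compose plane_continuous g_cont)
  moreover have "inj_on ?e double_broom"
    by (intro comp_inj_on inj_plane[OF k] g_inj)
  ultimately show ?thesis
    unfolding broom_at_def using sub by (simp only: simp_thms)
qed

text \<open>The axis and the hairy disks form a compact set that meets the extra broom only in its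
  center.\<close>

lemma broom_at_Y: "broom_at Y extra_broom"
proof -
  let ?R = "closed_axis \<union> (\<Union>k\<in>{2..}. hcopy H k)"
  have sub: "extra_broom ` double_broom \<subseteq> Y" by (auto simp: WBH_o_def broom_copy_eq)
  have "openin (top_of_set Y) (Y \<inter> - ?R)"
    by (intro openin_open_Int open_Compl compact_imp_closed compact_axis_disks) auto
  moreover have "extra_broom 0 \<in> ?R" by (auto simp: extra_broom_def closed_axis_def)
  then have "Y \<inter> - ?R = extra_broom ` (double_broom - {0})"
  proof -
    assume z: "extra_broom 0 \<in> ?R"
    have "extra_broom p \<notin> ?R" if "p \<noteq> 0" for p using extra_broom_in_tail[of p] that by auto
    moreover have "p \<in> extra_broom ` (double_broom - {0})" if "p \<in> Y" "p \<notin> ?R" for p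
      proof -
      have "p \<in> extra_broom ` double_broom" using subsetD[OF Y_subset that(1)] that(2) broom_copy_eq by auto
      then show ?thesis using that(2) z by (metis DiffI image_iff singletonD)
    qed
    ultimately show ?thesis using sub by blast
  qed
  ultimately show ?thesis
    unfolding broom_at_def using sub extra_broom_continuous by (auto simp: inj_on_def extra_broom_def)
qed

text \<open>The inequality describes an open cone about the axis. It cuts the plane
  \<open>x = -1/k\<close> in the disk of radius \<open>1/(k * diameter H)\<close>, the image of the
  open unit disk, so \<open>U\<close> consists of all open disks and the arcs of the axis.\<close>

lemma open_disks_nullhomotopic:
  defines "U \<equiv> {p \<in> X. norm (snd p) * diameter H < - fst p}"
  shows "openin (top_of_set X) U" "homotopic_with_canon (\<lambda>_. True) U X id (\<lambda>_. (-1, 0))"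
proof -
  have "open {p :: real \<times> real \<times> real. norm (snd p) * diameter H < - fst p}"
    by (intro open_Collect_less continuous_intros)
  then have "openin (top_of_set X) (X \<inter> {p. norm (snd p) * diameter H < - fst p})"
    by (rule openin_open_Int)
  moreover have "X \<inter> {p. norm (snd p) * diameter H < - fst p} = U" by (auto simp: U_def)
  ultimately show "openin (top_of_set X) U" by simp
  have cases: "(\<exists>x. -1 \<le> x \<and> x < 0 \<and> p = (x, 0)) \<or> (\<exists>k q. k \<ge> 1 \<and> norm q < 1 \<and> p = plane k q)"
    if p: "p \<in> U" for p
  proof -
    have "p \<in> X" "norm (snd p) * diameter H < - fst p" using p by (auto simp: U_def)
    from X_cases[OF this(1)] this(2) show ?thesis
    proof cases
      case (3 k q)
      have "norm (snd p) * diameter H = norm q / real k"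
        using 3 diameter_H_pos by (simp add: plane_def)
      then have "norm q / real k < 1 / real k" using 3 \<open>norm (snd p) * diameter H < - fst p\<close> by simp
      then have "norm q < 1" using 3 by (simp add: divide_less_cancel)
      then show ?thesis using 3 by blast
    qed auto
  qed
  \<comment> \<open>First every disk is contracted along its radii to its center on the
    axis.\<close>
  have "homotopic_with_canon (\<lambda>_. True) U X id (\<lambda>p. (fst p, 0))"
  proof (rule homotopic_with_linear)
    fix p assume "p \<in> U"
    with cases consider x where "-1 \<le> x" "x < 0" "p = (x, 0)" | k q where "k \<ge> 1" "norm q < 1" "p = plane k q" by blast
    then show "closed_segment (id p) (fst p, 0) \<subseteq> X"
    proof cases
      case 1
      then show ?thesis using axis_in_X[of x] by auto
    next
      case 2
      have "closed_segment p (fst p, 0) \<subseteq> plane k ` cball 0 1"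
      proof
        fix z assume "z \<in> closed_segment p (fst p, 0)"
        then obtain t where t: "0 \<le> t" "t \<le> 1" "z = (1 - t) *\<^sub>R p + t *\<^sub>R (fst p, 0)"
          by (auto simp: closed_segment_def)
        have "z = plane k ((1 - t) *\<^sub>R q)"
          unfolding t(3) 2(3) plane_def
          by (rule prod_eqI) (simp_all only: fst_add snd_add fst_scaleR snd_scaleR fst_conv snd_conv
              scaleR_scaleR mult.commute scaleR_zero_right add_0_right scaleR_add_left[symmetric] diff_add_cancel scaleR_one)
        moreover have "norm ((1 - t) *\<^sub>R q) \<le> 1"
          using t 2 by (simp add: mult_le_one)
        ultimately show "z \<in> plane k ` cball 0 1" by (intro image_eqI) auto
      qed
      then show ?thesis using disk_subset_H 2(1) by (force simp: WH_o_def hcopy_eq)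
    qed
  qed (auto intro!: continuous_intros)
  \<comment> \<open>Then the axis is contracted to its end \<open>(-1, 0)\<close>.\<close>
  moreover have "homotopic_with_canon (\<lambda>_. True) U X (\<lambda>p. (fst p, 0)) (\<lambda>_. (-1, 0))"
  proof (rule homotopic_with_linear)
    fix p assume "p \<in> U"
    then have p: "-1 \<le> fst p" "fst p < 0" using cases[of p] by (auto simp: field_simps)
    show "closed_segment (fst p, 0) (-1, 0) \<subseteq> X"
    proof
      fix z assume "z \<in> closed_segment (fst p, 0) (-1, 0 :: real \<times> real)"
      then have "fst z \<in> closed_segment (fst p) (-1)" "snd z \<in> closed_segment 0 (0 :: real \<times> real)"
        by (metis closed_segment_PairD prod.collapse)+
      then have "-1 \<le> fst z" "fst z < 0" "z = (fst z, 0)"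
        using p by (auto simp: closed_segment_eq_real_ivl prod_eq_iff split: if_splits)
      then show "z \<in> X" using axis_in_X by metis
    qed
  qed (auto intro!: continuous_intros)
  ultimately show "homotopic_with_canon (\<lambda>_. True) U X id (\<lambda>_. (-1, 0))"
    by (rule homotopic_with_trans)
qed

text \<open>\<open>X\<close> lies in the cone \<open>norm (snd p) \<le> - fst p\<close>, so a norm
  is at most twice the absolute value of the first coordinate and the slab
  \<open>- (d / 2) < fst p\<close> is small. The slab contains each hairy disk entirely or not at
  all, and those inside are joined to the origin along the axis.\<close>

lemma small_connected_neighbourhoods_of_origin:
  assumes "0 \<in> E" and U: "openin (top_of_set X) U" "0 \<in> U"
  shows "\<exists>V\<subseteq>U. openin (top_of_set X) V \<and> 0 \<in> V \<and> connected V"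
proof -
  obtain d where d: "d > 0" "ball 0 d \<inter> X \<subseteq> U"
    using U by (auto simp: openin_contains_ball)
  define V where "V = X \<inter> {p. - (d / 2) < fst p}"
  have norm_le: "norm (snd p) \<le> - fst p \<and> fst p \<le> 0" if "p \<in> X" for p
    using that
  proof (cases rule: X_cases)
    case (3 k q)
    then have "norm q / diameter H \<le> 1" using norm_le_diameter_H[of q] diameter_H_pos by simp
    then have "norm q / diameter H / real k \<le> 1 / real k" by (rule divide_right_mono) simp
    then show ?thesis using 3 diameter_H_pos by (simp add: plane_def mult.commute)
  qed auto
  have "V \<subseteq> U"
  proof
    fix p assume p: "p \<in> V"
    have "norm p \<le> norm (fst p) + norm (snd p)"
      using norm_Pair_le[of "fst p" "snd p"] by simp
    also have "\<dots> < d" using p norm_le[of p] by (auto simp: V_def)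
    finally show "p \<in> U" using d p by (auto simp: V_def)
  qed
  moreover have "openin (top_of_set X) V"
    unfolding V_def by (intro openin_open_Int open_Collect_less continuous_intros)
  moreover have "0 \<in> V" using assms d by (auto simp: V_def)
  moreover have "connected V"
  proof -
    have "\<exists>C. connected C \<and> 0 \<in> C \<and> p \<in> C \<and> C \<subseteq> V" if p: "p \<in> V" for p
    proof -
      let ?A = "(\<lambda>x. (x, 0 :: real \<times> real)) ` {fst p..0}"
      have "fst p \<le> 0" using norm_le p by (auto simp: V_def)
      have ge: "-1 \<le> fst p"
        using p subsetD[OF X_subset, of p] by (auto simp: V_def closed_axis_def hcopy_eq field_simps)
      have A: "connected ?A" by (intro connected_continuous_image) (auto intro!: continuous_intros)
      have "?A \<subseteq> V"
      proof (intro image_subsetI)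
        fix x assume x: "x \<in> {fst p..0}"
        then have "(x, 0) \<in> X"
          using axis_in_X[of x] ge \<open>0 \<in> E\<close> by (cases "x = 0") (auto simp: zero_prod_def)
        then show "(x, 0) \<in> V" using x p by (auto simp: V_def)
      qed
      have zA: "0 \<in> ?A" using \<open>fst p \<le> 0\<close> by (auto simp: zero_prod_def)
      have "p \<in> X" using p by (simp add: V_def)
      then show ?thesis
      proof (cases rule: X_cases)
        case (3 k q)
        have "plane k 0 \<in> ?A \<inter> plane k ` H"
          using 3 \<open>fst p \<le> 0\<close> by (auto intro!: image_eqI[of _ _ "- 1 / real k"] image_eqI[of _ _ 0] simp: plane_zero[of k])
        then have "connected (?A \<union> plane k ` H)"
          by (intro connected_Un[OF A connected_continuous_image[OF plane_continuous connected_H]]) blast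
        moreover have "plane k ` H \<subseteq> V"
          using p 3 plane_in_X[OF 3(1)] unfolding V_def
          by (intro image_subsetI IntI) (simp_all only: mem_Collect_eq fst_plane Int_iff)
        ultimately show ?thesis using 3 zA \<open>?A \<subseteq> V\<close> by (intro exI[of _ "?A \<union> plane k ` H"]) auto
      qed (use A zA \<open>?A \<subseteq> V\<close> in \<open>auto intro!: exI[of _ ?A]\<close>)
    qed
    then obtain C where C: "\<And>p. p \<in> V \<Longrightarrow> connected (C p) \<and> 0 \<in> C p \<and> p \<in> C p \<and> C p \<subseteq> V" by metis
    then have "V = \<Union> (C ` V)" by auto
    moreover have "0 \<in> \<Inter> (C ` V)" using C by blast
    then have "connected (\<Union> (C ` V))" using C by (intro connected_Union) blast+
    ultimately show ?thesis by simp
  qed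
  ultimately show ?thesis by blast
qed

end

end

section \<open>The spaces are not homotopy equivalent\<close>

context hairy_disk_data
begin

text \<open>The centers of the attached brooms are fixed, and they are dense in the circle.\<close>

lemma circle_fixed:
  assumes E: "E \<subseteq> {0}" and k: "k \<ge> 1" and q: "norm q = 1"
    and \<phi>: "homotopic_with_canon (\<lambda>_. True) (WH_o H \<union> E) (WH_o H \<union> E) \<phi> id"
  shows "\<phi> (plane k q) = plane k q"
proof -
  let ?X = "WH_o H \<union> E"
  have cont: "continuous_on ?X \<phi>"
    using homotopic_with_imp_continuous_maps[OF \<phi>] by auto
  have fixed: "\<phi> (plane k (m i)) = plane k (m i)" for i
  proof -
    note e = broom_at_X[OF E k, of i]
    have "(plane k \<circ> g i) 0 \<in> ?X" using e zero_in_brooms(2) unfolding broom_at_def by blast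
    from homotopy_fixes_center(1)[OF e openin_subtopology_self this homotopic_with_symD[OF \<phi>]]
    show ?thesis by (simp add: g_center)
  qed
  have "closure (range m) \<subseteq> sphere 0 1"
    using m_sphere by (intro closure_minimal) auto
  then have into: "plane k ` closure (range m) \<subseteq> ?X"
    using plane_in_X[OF E k] disk_subset_H sphere_cball[of 0 1] by blast
  show ?thesis
  proof (rule fixed_on_closure[of "range m" "\<phi> \<circ> plane k" "plane k" q, unfolded o_def])
    show "continuous_on (closure (range m)) (\<lambda>x. \<phi> (plane k x))"
      using into by (intro continuous_on_compose2[OF cont] plane_continuous)
    show "q \<in> closure (range m)" using m_dense q by auto
  qed (use fixed plane_continuous in auto)
qed

lemma injective_on_circle:
  assumes E: "E \<subseteq> {0}" and k: "k \<ge> 1"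
    and hom: "homotopic_with_canon (\<lambda>_. True) (WH_o H \<union> E) (WH_o H \<union> E) (g' \<circ> f') id"
  shows "inj_on f' (plane k ` sphere 0 1)"
proof (rule inj_on_inverseI[of _ g'])
  fix x assume "x \<in> plane k ` sphere 0 1"
  then show "g' (f' x) = x" using circle_fixed[OF E k _ hom] by auto
qed

text \<open>Without the center of the extra broom the target splits into three open legs. The rest
  of the closed curve is connected, so it lies in one leg. Close to the center the curve would then
  be an injective arc on a segment ending there, passing through the end at an interior
  time.\<close>

lemma no_circle_through_extra_broom:
  assumes E: "E \<subseteq> {0}" and k: "k \<ge> 1" and q0: "norm q0 = 1"
    and f: "continuous_on (WH_o H \<union> E) f" "f \<in> (WH_o H \<union> E) \<rightarrow> (WBH_o H \<union> E)"
    and inj: "inj_on f (plane k ` sphere 0 1)"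
    and b: "f (plane k q0) = extra_broom 0"
  shows False
proof -
  let ?X = "WH_o H \<union> E" and ?Y = "WBH_o H \<union> E"
  let ?e = "extra_broom" and ?e' = "extra_broom \<circ> uminus"
  have "(fst q0)\<^sup>2 + (snd q0)\<^sup>2 = 1"
    using q0 by (simp add: norm_prod_def)
  then obtain \<theta> where \<theta>: "fst q0 = cos \<theta>" "snd q0 = sin \<theta>" by (rule sincos_total_2pi)
  define loop where "loop t = (cos (\<theta> + t), sin (\<theta> + t))" for t
  have loop_sphere: "loop t \<in> sphere 0 1" for t
    by (simp add: loop_def norm_Pair)
  have loop_eq: "\<exists>n::int. s = t + 2 * pi * n" if "loop s = loop t" for s t
  proof -
    have "\<exists>n::int. \<theta> + s = \<theta> + t + 2 * pi * n"
      using that unfolding loop_def by (intro iffD1[OF sin_cos_eq_iff]) auto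
    then show ?thesis by auto
  qed
  define q where "q t = f (plane k (loop t))" for t
  have loop_X: "plane k (loop t) \<in> ?X" for t
    using plane_in_X[OF E k, of "loop t"] subsetD[OF disk_subset_H, of "loop t"] loop_sphere[of t] by simp
  have q_cont: "continuous_on S q" for S
    unfolding q_def loop_def plane_def
    by (intro continuous_on_compose2[OF f(1)] continuous_intros)
      (use loop_X in \<open>auto simp: plane_def loop_def\<close>)
  have q_Y: "q t \<in> ?Y" for t using f(2) loop_X[of t] unfolding q_def by blast
  have q_eq: "\<exists>n::int. s = t + 2 * pi * n" if "q s = q t" for s t
  proof -
    have "plane k (loop s) = plane k (loop t)"
      using that inj loop_sphere unfolding q_def by (auto dest!: inj_onD)
    then show ?thesis using plane_eq_iff[OF k] loop_eq by auto
  qed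
  have q_periodic: "q (t + 2 * pi) = q t" for t
    by (simp add: q_def loop_def add.assoc[symmetric])
  have "loop 0 = q0" by (simp add: loop_def \<theta>[symmetric])
  then have q_0: "q 0 = ?e 0" by (simp add: q_def b)
  \<comment> \<open>Times in this interval differ by at most 2, which is less than the
    period.\<close>
  have q_inj: "inj_on q {-1..1}"
  proof (rule inj_onI)
    fix s t assume st: "s \<in> {-1..1}" "t \<in> {-1..1}" "q s = q t"
    then obtain n :: int where n: "s = t + 2 * pi * n" using q_eq by blast
    have "\<bar>2 * pi * n\<bar> \<le> 2" using st n by auto
    then have "\<bar>real_of_int n\<bar> * (2 * pi) \<le> 2" by (simp add: abs_mult mult.commute)
    moreover have "2 < 2 * pi" using pi_gt3 by simp
    ultimately have "\<not> 1 \<le> \<bar>real_of_int n\<bar>"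
      using mult_right_mono[of 1 "\<bar>real_of_int n\<bar>" "2 * pi"] by linarith
    then have "n = 0" by linarith
    then show "s = t" using n by simp
  qed
  have q_ne: "q t \<noteq> ?e 0" if "0 < t" "t < 2 * pi" for t
  proof
    assume "q t = ?e 0"
    then obtain n :: int where n: "t = 0 + 2 * pi * n" using q_eq[of t 0] q_0 by auto
    then have "0 < real_of_int n" "real_of_int n < 1" using that by (auto simp: zero_less_mult_iff)
    then show False by simp
  qed
  \<comment> \<open>Negative times are moved by one period into the open interval.\<close>
  have arc: "q t \<in> insert (?e 0) (q ` {0<..<2 * pi})" if "-1 \<le> t" "t \<le> 1" for t
  proof -
    consider "t = 0" | "0 < t" | "t < 0" by linarith
    then show ?thesis
    proof cases
      case 2 then show ?thesis using that pi_gt3 by auto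
    next
      case 3
      then have "t + 2 * pi \<in> {0<..<2 * pi}" using that pi_gt3 by auto
      then show ?thesis using q_periodic[of t] by (metis image_eqI insertI2)
    qed (simp add: q_0)
  qed
  note e = broom_at_Y[OF E]
  \<comment> \<open>The legs: \<open>?A\<close> and \<open>?B\<close> are the halves of the extra
    broom without their common center, and \<open>?R\<close> contains the arc leading to the hairy
    disks.\<close>
  let ?A = "?e ` (upper_broom - {0})" and ?B = "?e' ` (upper_broom - {0})"
  let ?R = "?Y \<inter> {p. -1 < fst p}"
  have open_A: "openin (top_of_set ?Y) ?A" and open_B: "openin (top_of_set ?Y) ?B"
    using half_broom_nullhomotopic(1)[OF e] half_broom_nullhomotopic(1)[OF broom_at_uminus[OF e]] .
  have open_R: "openin (top_of_set ?Y) ?R"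
    by (intro openin_open_Int open_Collect_less continuous_intros)
  have fst_e: "fst (?e p) = -1" for p by (simp add: extra_broom_def)
  have inj_e: "?e p = ?e p' \<longleftrightarrow> p = p'" for p p' by (simp add: extra_broom_def)
  have AB: "?A \<inter> ?B = {}"
  proof (rule ccontr)
    assume "?A \<inter> ?B \<noteq> {}"
    then obtain z where z: "z \<in> ?A" "z \<in> ?B" by blast
    obtain p where p: "p \<in> upper_broom - {0}" "z = ?e p" using z(1) by (rule imageE)
    obtain p' where p': "p' \<in> upper_broom - {0}" "z = ?e' p'" using z(2) by (rule imageE)
    then have "p \<in> upper_broom \<inter> uminus ` upper_broom" using p by (auto simp: inj_e)
    then show False using upper_broom_Int_lower p by blast
  qed
  have cover: "z \<in> ?A \<union> (?B \<union> ?R)" if z: "z \<in> ?Y" "z \<noteq> ?e 0" for z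
  proof (cases "z \<in> broom_copy")
    case True
    then obtain p where p: "z = ?e p" "p \<in> double_broom" unfolding broom_copy_eq by (rule imageE)
    then have "p \<noteq> 0" using z(2) by auto
    then consider "p \<in> upper_broom" | p' where "p' \<in> upper_broom" "p = - p'"
      using p(2) unfolding double_broom_eq by blast
    then show ?thesis
    proof cases
      case 2
      then have "z = ?e' p'" "p' \<in> upper_broom - {0}" using p \<open>p \<noteq> 0\<close> by auto
      then have "z \<in> ?B" by (rule image_eqI)
      then show ?thesis by (rule UnI2[OF UnI1])
    qed (use p \<open>p \<noteq> 0\<close> in auto)
  next
    case False
    then consider x where "-1 \<le> x" "z = (x, 0)" | j p where "j \<ge> 2" "z = plane j p"
      using subsetD[OF Y_subset[OF E] z(1)] by (auto simp: closed_axis_def hcopy_eq)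
    then have "-1 < fst z"
    proof cases
      case 1
      then have "x \<noteq> -1" using z(2) by (auto simp: extra_broom_def)
      then show ?thesis using 1 by simp
    next
      case 2
      then show ?thesis by (simp add: field_simps)
    qed
    then show ?thesis using z by simp
  qed
  let ?C = "q ` {0<..<2 * pi}"
  have conn: "connected ?C" by (intro connected_continuous_image q_cont) auto
  have C_sub: "?C \<subseteq> ?A \<union> (?B \<union> ?R)"
    using cover q_Y q_ne by (intro image_subsetI) auto
  have disj: "?A \<inter> (?B \<union> ?R) = {}" "?B \<inter> ?R = {}"
    using AB fst_e by auto
  have "?C \<subseteq> ?A \<or> ?C \<subseteq> ?B \<union> ?R"
    by (rule connected_in_open_pieces[OF conn open_A openin_Un[OF open_B open_R] C_sub disj(1)])
  moreover have "?C \<subseteq> ?B \<or> ?C \<subseteq> ?R" if "?C \<subseteq> ?B \<union> ?R"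
    by (rule connected_in_open_pieces[OF conn open_B open_R that disj(2)])
  ultimately consider "?C \<subseteq> ?A" | "?C \<subseteq> ?B" | "?C \<subseteq> ?R" by blast
  then show False
  proof cases
    case 1
    then have "q ` {-1..1} \<subseteq> ?e ` upper_broom" using arc by fastforce
    then show False
      using no_injective_arc_in_half_broom[OF e q_cont q_0 q_inj] by simp
  next
    case 2
    then have "q ` {-1..1} \<subseteq> ?e' ` upper_broom"
      using arc zero_in_brooms(1) by (intro image_subsetI) (fastforce intro: image_eqI[of _ _ 0])
    then show False
      using no_injective_arc_in_half_broom[OF broom_at_uminus[OF e] q_cont _ q_inj] q_0 by simp
  next
    case 3
    \<comment> \<open>The hairy disks of \<open>?Y\<close> begin at \<open>x = -1/2\<close>. Before
      this plane the third leg is only the axis, along which the first coordinate is minimal at the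
      center of the extra broom.\<close>
    have "open ((\<lambda>t. fst (q t)) -` {..< -1/2})"
      by (intro open_vimage continuous_on_fst q_cont) auto
    moreover have "0 \<in> (\<lambda>t. fst (q t)) -` {..< -1/2}" by (simp add: q_0 fst_e)
    ultimately obtain d where d: "d > 0" "cball 0 d \<subseteq> (\<lambda>t. fst (q t)) -` {..< -1/2}"
      by (metis open_contains_cball)
    define a where "a = min d 1"
    have a: "0 < a" "a \<le> 1" "a \<le> d" using d by (auto simp: a_def)
    have form: "q t = (fst (q t), 0) \<and> -1 \<le> fst (q t)" if t: "-a \<le> t" "t \<le> a" for t
    proof (cases "q t = ?e 0")
      case True
      then show ?thesis by (simp add: extra_broom_def)
    next
      case False
      then have "q t \<in> ?R" using arc[of t] 3 a t by auto
      then have gt: "-1 < fst (q t)" by simp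
      have lt: "fst (q t) < -1/2" using d(2) t a by (auto simp: subset_iff dist_norm)
      have "q t \<notin> hcopy H j" if "j \<ge> 2" for j
      proof
        assume "q t \<in> hcopy H j"
        then have "fst (q t) = - 1 / real j" by (auto simp: hcopy_eq)
        moreover have "1 / real j \<le> 1/2" using that by (simp add: field_simps)
        ultimately show False using lt by simp
      qed
      moreover have "q t \<notin> broom_copy" using gt fst_e by (auto simp: broom_copy_eq)
      ultimately have "q t \<in> closed_axis" using subsetD[OF Y_subset[OF E] q_Y[of t]] by auto
      then show ?thesis by (auto simp: closed_axis_def)
    qed
    show False
    proof (rule no_injective_arc_at_minimum[of a "\<lambda>t. fst (q t)"])
      show "inj_on (\<lambda>t. fst (q t)) {-a..a}"
      proof (rule inj_onI)
        fix s t assume st: "s \<in> {-a..a}" "t \<in> {-a..a}" "fst (q s) = fst (q t)"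
        then have "q s = q t" using form[of s] form[of t] by (auto simp: prod_eq_iff)
        then show "s = t" using q_inj st a by (auto dest!: inj_onD)
      qed
    qed (use a form q_0 fst_e in \<open>auto intro!: continuous_on_fst q_cont\<close>)
  qed
qed

theorem not_homotopy_eqv:
  assumes E: "E \<subseteq> {0}"
  shows "\<not> (WH_o H \<union> E) homotopy_eqv (WBH_o H \<union> E)"
proof
  let ?X = "WH_o H \<union> E" and ?Y = "WBH_o H \<union> E"
  assume "?X homotopy_eqv ?Y"
  then obtain f h where f: "continuous_on ?X f" "f \<in> ?X \<rightarrow> ?Y"
    and h: "continuous_on ?Y h" "h \<in> ?Y \<rightarrow> ?X"
    and hf: "homotopic_with_canon (\<lambda>_. True) ?X ?X (h \<circ> f) id"
    and fh: "homotopic_with_canon (\<lambda>_. True) ?Y ?Y (f \<circ> h) id"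
    unfolding homotopy_equivalent_space_def by (auto simp: image_subset_iff_funcset)
  note e = broom_at_Y[OF E]
  have bY: "extra_broom 0 \<in> ?Y" using e zero_in_brooms(2) unfolding broom_at_def by blast
  define x where "x = h (extra_broom 0)"
  have x: "x \<in> ?X" using h(2) bY by (auto simp: x_def)
  have fx: "f x = extra_broom 0"
    using homotopy_fixes_center(1)[OF e openin_subtopology_self bY homotopic_with_symD[OF fh]] by (simp add: x_def)
  note null = right_inverse_no_nullhomotopic_neighbourhood[OF e f h fh, folded x_def]
  let ?U = "{p \<in> ?X. norm (snd p) * diameter H < - fst p}"
  have "x \<notin> ?U" using null[OF open_disks_nullhomotopic(1)[OF E] _ open_disks_nullhomotopic(2)[OF E]] by blast
  \<comment> \<open>\<open>?U\<close> contains the arcs of the axis and the open disks, so only the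
    origin, the circles and the brooms remain for \<open>x\<close>.\<close>
  then have not_disk: "- fst x \<le> norm (snd x) * diameter H" using x by auto
  show False
  proof (cases rule: X_cases[OF E x, consumes 0, case_names origin axis disk])
    case origin
    have "h (extra_broom 0) = 0" using origin(1) unfolding x_def .
    note no_small = right_inverse_no_small_connected_neighbourhoods[OF e f h fh, unfolded this]
    show False
      by (rule no_small) (rule small_connected_neighbourhoods_of_origin[OF E origin(2)])
  next
    case axis
    then show False using not_disk by auto
  next
    case 3: (disk k q)
    have "norm (snd x) * diameter H = norm q / real k"
      using 3 diameter_H_pos by (simp add: plane_def)
    then have "1 / real k \<le> norm q / real k" using 3 not_disk by simp
    then have "1 \<le> norm q" using 3 by (simp add: divide_le_cancel)
    \<comment> \<open>Either \<open>q\<close> is on the boundary circle, or it lies in a broom off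
      its center, and hence in an open half broom that contracts in \<open>?X\<close>.\<close>
    then consider "norm q = 1" | "norm q > 1" by linarith
    then show False
    proof cases
      case 1
      then show False
        using no_circle_through_extra_broom[OF E 3(1) 1 f injective_on_circle[OF E 3(1) hf]] fx 3 by blast
    next
      case 2
      then obtain i p where p: "p \<in> double_broom" "q = g i p" using 3 H_eq by auto
      then have "p \<noteq> 0" using 2 by (auto simp: g_center)
      note ei = broom_at_X[OF E 3(1), of i]
      consider "p \<in> upper_broom" | p' where "p' \<in> upper_broom" "p = - p'"
        using p by (auto simp: double_broom_eq)
      then show False
      proof cases
        case 1
        then have "x \<in> (plane k \<circ> g i) ` (upper_broom - {0})" using 3 p \<open>p \<noteq> 0\<close> by auto
        then show False using null half_broom_nullhomotopic[OF ei] by blast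
      next
        case (2 p')
        then have "x = (plane k \<circ> g i \<circ> uminus) p'" "p' \<in> upper_broom - {0}" using 3 p \<open>p \<noteq> 0\<close> by auto
        then have "x \<in> (plane k \<circ> g i \<circ> uminus) ` (upper_broom - {0})" by (rule image_eqI)
        then show False using null half_broom_nullhomotopic[OF broom_at_uminus[OF ei]] by blast
      qed
    qed
  qed
qed

end

section \<open>The spaces dominate each other\<close>

text \<open>A strict left inverse suffices; both dominations below are of this kind.\<close>

lemma hdominatedI:
  assumes "continuous_on X f" "f \<in> X \<rightarrow> Y" "continuous_on Y h" "h \<in> Y \<rightarrow> X" "\<And>x. x \<in> X \<Longrightarrow> h (f x) = x"
  shows "hdominated X Y"
proof -
  have "homotopic_with_canon (\<lambda>_. True) X X (h \<circ> f) id"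
    using assms by (intro homotopic_with_equal) (auto intro!: continuous_on_compose2[OF assms(3)])
  then show ?thesis
    using assms unfolding hdominated_def by (auto simp: image_subset_iff_funcset)
qed

text \<open>The pasting lemma in a form that returns the glued map with its two equations, so that
  no case distinction has to be unfolded later.\<close>

lemma continuous_on_glue:
  assumes "closed S" "closed T" "Z \<subseteq> S \<union> T" "continuous_on (Z \<inter> S) f" "continuous_on (Z \<inter> T) h"
    and "\<And>x. \<lbrakk>x \<in> Z; x \<in> S; x \<in> T\<rbrakk> \<Longrightarrow> f x = h x"
  obtains u where "continuous_on Z u" "\<And>x. \<lbrakk>x \<in> Z; x \<in> S\<rbrakk> \<Longrightarrow> u x = f x" "\<And>x. \<lbrakk>x \<in> Z; x \<in> T\<rbrakk> \<Longrightarrow> u x = h x"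
proof -
  have Z: "(Z \<inter> S) \<union> (Z \<inter> T) = Z" using assms(3) by auto
  have "continuous_on (Z \<inter> S \<union> Z \<inter> T) (\<lambda>x. if x \<in> S then f x else h x)"
    using assms unfolding Z
    by (intro continuous_on_cases_local[of "Z \<inter> S" "Z \<inter> T", unfolded Z] closedin_closed_Int) auto
  then have "continuous_on Z (\<lambda>x. if x \<in> S then f x else h x)" unfolding Z .
  then show thesis by (rule that) (use assms(6) in auto)
qed

text \<open>The arc \<open>[c(1), c(2)]\<close>, which in \<open>WBH_o\<close> joins the extra broom
  to the first hairy disk.\<close>

definition first_arc :: "(real \<times> real \<times> real) set" where
  "first_arc = (\<lambda>x. (x, 0)) ` {-1..-1/2}"

text \<open>The half-space beginning at the plane of \<open>H(2)\<close>, in which both spaces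
  coincide.\<close>

definition tail_space :: "(real \<times> real \<times> real) set" where
  "tail_space = {p. -1/2 \<le> fst p}"

lemma closed_first_arc: "closed first_arc"
  unfolding first_arc_def
  by (intro compact_imp_closed compact_continuous_image) (auto intro!: continuous_intros)

lemma closed_tail_space: "closed tail_space"
  unfolding tail_space_def by (intro closed_Collect_le continuous_intros)

lemma first_arc_Int_tail: "\<lbrakk>p \<in> first_arc; p \<in> tail_space\<rbrakk> \<Longrightarrow> p = (-1/2, 0)"
  by (auto simp: first_arc_def tail_space_def)

lemma extra_broom_not_in_tail: "extra_broom p \<notin> tail_space"
  by (auto simp: extra_broom_def tail_space_def)

lemma extra_broom_in_first_arc: "extra_broom p \<in> first_arc \<Longrightarrow> p = 0"
  by (auto simp: extra_broom_def first_arc_def)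

lemma compact_broom_copy: "compact broom_copy"
  unfolding broom_copy_eq by (intro compact_continuous_image extra_broom_continuous compact_double_broom)

context hairy_disk_data
begin

context
  fixes E :: "(real \<times> real \<times> real) set"
  assumes E: "E \<subseteq> {0}"
begin

section \<open>Decomposition of both spaces at the plane x = -1/2\<close>

lemma plane_in_tail: "k \<ge> 1 \<Longrightarrow> plane k p \<in> tail_space \<longleftrightarrow> k \<ge> 2"
  by (auto simp: tail_space_def field_simps)

lemma first_arc_sub: "first_arc \<subseteq> X E" "first_arc \<subseteq> Y E"
  by (auto simp: first_arc_def WH_o_def WBH_o_def axis_arcs_def zero_prod_def)

lemma tail_eq: "p \<in> tail_space \<Longrightarrow> p \<in> X E \<longleftrightarrow> p \<in> Y E"
proof -
  assume p: "p \<in> tail_space"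
  have "p \<in> hcopy H k \<Longrightarrow> k \<ge> 1 \<Longrightarrow> k \<ge> 2" for k
    using p plane_in_tail by (auto simp: hcopy_eq)
  moreover have "p \<notin> broom_copy" using p extra_broom_not_in_tail by (auto simp: broom_copy_eq)
  ultimately show ?thesis
    unfolding WH_o_def WBH_o_def by (auto intro: order_trans[of 1 2])
qed

lemma X_cover:
  assumes "p \<in> X E" shows "p \<in> plane 1 ` H \<or> p \<in> first_arc \<or> p \<in> tail_space"
proof (cases rule: X_cases[OF E assms, consumes 0, case_names origin axis disk])
  case (disk k q)
  then show ?thesis using plane_in_tail[of k q] by (cases "k = 1") auto
qed (auto simp: first_arc_def tail_space_def)

lemma Y_cover: "p \<in> Y E \<Longrightarrow> p \<in> broom_copy \<or> p \<in> first_arc \<or> p \<in> tail_space"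
proof -
  assume "p \<in> Y E"
  then consider "p \<in> broom_copy" | k where "k \<ge> 2" "p \<in> hcopy H k" | "p \<in> closed_axis"
    using Y_subset[OF E] by auto
  then show ?thesis
  proof cases
    case (2 k)
    then show ?thesis using plane_in_tail[of k] by (auto simp: hcopy_eq)
  next
    case 3
    then show ?thesis by (auto simp: closed_axis_def first_arc_def tail_space_def)
  qed simp
qed

text \<open>The projective map \<open>p \<mapsto> p / (1 - x)\<close> takes the plane \<open>x = -1/k\<close> to \<open>x = -1/(k+1)\<close>.\<close>

lemma shift_plane:
  assumes k: "k \<ge> 1"
  shows "(1 / (1 - fst (plane k q))) *\<^sub>R plane k q = plane (Suc k) q"
    and "(1 / (1 + fst (plane (Suc k) q))) *\<^sub>R plane (Suc k) q = plane k q"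
proof -
  have "1 - fst (plane k q) = (1 + real k) / real k" "1 + fst (plane (Suc k) q) = real k / (1 + real k)"
    using k by (simp_all add: field_simps)
  with k diameter_H_pos show "(1 / (1 - fst (plane k q))) *\<^sub>R plane k q = plane (Suc k) q"
    "(1 / (1 + fst (plane (Suc k) q))) *\<^sub>R plane (Suc k) q = plane k q"
    by (simp_all only: fst_plane) (auto simp: plane_def prod_eq_iff)
qed

lemma fst_le_0: "p \<in> X E \<Longrightarrow> fst p \<le> 0"
  using subsetD[OF X_subset[OF E], of p] by (auto simp: closed_axis_def hcopy_eq)

text \<open>\<open>?f\<close> shifts all factors by one into the part that both spaces share. The
  left inverse shifts back on that part and collapses the extra broom and the first arc to
  \<open>(-1, 0)\<close>; the pieces fit because \<open>?h\<close> sends \<open>(-1/2, 0)\<close> to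
  \<open>(-1, 0)\<close>.\<close>

lemma hdominated_WH_WBH: "hdominated (X E) (Y E)"
proof -
  let ?f = "\<lambda>p::real \<times> real \<times> real. (1 / (1 - fst p)) *\<^sub>R p"
  let ?h = "\<lambda>p::real \<times> real \<times> real. (1 / (1 + fst p)) *\<^sub>R p"
  let ?S = "broom_copy \<union> first_arc"
  have ft: "?f p \<in> X E \<and> ?f p \<in> tail_space" if "p \<in> X E" for p
  proof (cases rule: X_cases[OF E that, consumes 0, case_names origin axis disk])
    case (axis x)
    have "-1/2 \<le> x / (1 - x)" "x / (1 - x) < 0"
      using axis by (auto simp: field_simps)
    then show ?thesis using axis axis_in_X[OF E, of "x / (1 - x)"] by (simp add: tail_space_def)
  next
    case (disk k q)
    then have "?f p = plane (Suc k) q" using shift_plane(1) by simp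
    then show ?thesis using disk plane_in_X[OF E, of "Suc k" q] plane_in_tail[of "Suc k" q] by auto
  qed (auto simp: tail_space_def)
  have f_cont: "continuous_on (X E) ?f"
    using fst_le_0 by (intro continuous_intros) fastforce
  have f_Y: "?f \<in> X E \<rightarrow> Y E" using ft tail_eq by blast
  have h_cont: "continuous_on (Y E \<inter> tail_space) ?h"
    by (intro continuous_intros) (auto simp: tail_space_def)
  have agree: "(-1, 0) = ?h p" if "p \<in> ?S" "p \<in> tail_space" for p
  proof -
    have "p \<in> first_arc" using that extra_broom_not_in_tail by (auto simp: broom_copy_eq)
    then have "p = (-1/2, 0)" using that(2) by (rule first_arc_Int_tail)
    then show ?thesis by simp
  qed
  obtain u where u: "continuous_on (Y E) u" "\<And>p. \<lbrakk>p \<in> Y E; p \<in> ?S\<rbrakk> \<Longrightarrow> u p = (-1, 0)"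
    "\<And>p. \<lbrakk>p \<in> Y E; p \<in> tail_space\<rbrakk> \<Longrightarrow> u p = ?h p"
    by (rule continuous_on_glue[of ?S tail_space "Y E" "\<lambda>_. (-1, 0)" ?h])
      (use Y_cover closed_first_arc closed_tail_space compact_broom_copy h_cont agree in
        \<open>auto simp: compact_imp_closed\<close>)
  show ?thesis
  proof (rule hdominatedI[OF f_cont f_Y u(1)])
    show "u \<in> Y E \<rightarrow> X E"
    proof
      fix p assume p: "p \<in> Y E"
      show "u p \<in> X E"
      proof (cases "p \<in> tail_space")
        case True
        then have "p \<in> X E" using p tail_eq by blast
        then have "?h p \<in> X E"
        proof (cases rule: X_cases[OF E \<open>p \<in> X E\<close>, consumes 0, case_names origin axis disk])
          case (axis x)
          then have "-1/2 \<le> x" using True by (simp add: tail_space_def)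
          then have "-1 \<le> x / (1 + x)" "x / (1 + x) < 0"
            using axis by (auto simp: field_simps divide_less_0_iff)
          then show ?thesis using axis axis_in_X[OF E, of "x / (1 + x)"] by simp
        next
          case (disk k q)
          then have "k \<ge> 2" using True plane_in_tail by simp
          then obtain j where j: "k = Suc j" "j \<ge> 1" by (cases k) auto
          then have "?h p = plane j q" using shift_plane(2) disk by simp
          then show ?thesis using plane_in_X[OF E j(2)] disk by simp
        qed auto
        then show ?thesis using u(3)[OF p True] by simp
      next
        case False
        then have "u p = (-1, 0)" using Y_cover[OF p] u(2)[OF p] by blast
        then show ?thesis using axis_in_X[OF E, of "-1"] by simp
      qed
    qed
    fix p assume p: "p \<in> X E"
    have le: "fst p \<le> 0" using fst_le_0 p by blast
    have "u (?f p) = ?h (?f p)" using u(3) ft[OF p] tail_eq by blast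
    also have "\<dots> = p"
    proof -
      have "1 + fst p / (1 - fst p) = 1 / (1 - fst p)" using le by (simp add: field_simps)
      then show ?thesis using le by simp
    qed
    finally show "u (?f p) = p" .
  qed
qed

text \<open>The extra broom goes to the broom of \<open>H(1)\<close> with index 0, and the first arc
  is stretched over a radius of \<open>H(1)\<close> followed by the first arc; the tail is
  unchanged. The left inverse \<open>v\<close> collapses \<open>H(1)\<close> to that broom and half
  an arc.\<close>

lemma hdominated_WBH_WH: "hdominated (Y E) (X E)"
proof -
  let ?D = "diameter H"
  \<comment> \<open>The disk with all brooms except the one with index 0, which is
    \<open>?G\<close>; the two sets meet only in \<open>m 0\<close>.\<close>
  let ?C = "cball 0 1 \<union> (\<Union>j\<in>-{0}. g j ` double_broom)"
  let ?G = "g 0 ` double_broom"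
  \<comment> \<open>For \<open>-1 \<le> x \<le> -3/4\<close> the factor \<open>- 4 x - 3\<close>
    falls from 1 to 0 and the image runs along the radius from \<open>m 0\<close> to the center;
    afterwards \<open>2 x + 1/2\<close> stretches the other half to the whole arc. The two maxima
    switch between these phases.\<close>
  let ?\<phi> = "\<lambda>p::real \<times> real \<times> real. (max (-1) (2 * fst p + 1/2), (1 / ?D * max 0 (- 4 * fst p - 3)) *\<^sub>R m 0)"
  \<comment> \<open>Doubling undoes the factor \<open>1/2\<close> in
    \<open>extra_broom\<close>.\<close>
  let ?\<beta> = "\<lambda>p::real \<times> real \<times> real. plane 1 (g 0 (2 *\<^sub>R snd p))"
  let ?AT = "first_arc \<union> tail_space"
  note D = diameter_H_pos
  have "insert 0 (- {0}) = (UNIV :: nat set)" by auto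
  with UN_insert[of "\<lambda>j. g j ` double_broom" 0 "- {0}"]
  have "(\<Union>j. g j ` double_broom) = ?G \<union> (\<Union>j\<in>-{0}. g j ` double_broom)"
    by (simp only:)
  then have H_CG: "H = ?C \<union> ?G" unfolding H_eq by (simp only: Un_ac)
  have AT: "closed ?AT" using closed_first_arc closed_tail_space by auto
  have zm: "(-1/2, 0) \<in> first_arc" by (auto simp: first_arc_def)

  obtain u1 where u1: "continuous_on (Y E \<inter> ?AT) u1"
    "\<And>p. \<lbrakk>p \<in> Y E \<inter> ?AT; p \<in> first_arc\<rbrakk> \<Longrightarrow> u1 p = ?\<phi> p"
    "\<And>p. \<lbrakk>p \<in> Y E \<inter> ?AT; p \<in> tail_space\<rbrakk> \<Longrightarrow> u1 p = p"
  proof (rule continuous_on_glue[OF closed_first_arc closed_tail_space, of "Y E \<inter> ?AT" ?\<phi> "\<lambda>p. p"])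
    fix p assume "p \<in> first_arc" "p \<in> tail_space"
    then have "p = (-1/2, 0)" by (rule first_arc_Int_tail)
    then show "?\<phi> p = p" by simp
  qed (use D in \<open>auto intro!: continuous_intros\<close>)
  have \<beta>_eq: "?\<beta> (extra_broom r) = plane 1 (g 0 r)" for r
    by (simp add: extra_broom_def)
  have \<beta>_cont: "continuous_on broom_copy ?\<beta>"
  proof (rule continuous_on_compose2[OF plane_continuous continuous_on_compose2[OF g_cont]])
    show "continuous_on broom_copy (\<lambda>p. 2 *\<^sub>R snd p)" by (intro continuous_intros)
  qed (auto simp: broom_copy_eq extra_broom_def)
  obtain u where u: "continuous_on (Y E) u" "\<And>p. \<lbrakk>p \<in> Y E; p \<in> broom_copy\<rbrakk> \<Longrightarrow> u p = ?\<beta> p"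
    "\<And>p. \<lbrakk>p \<in> Y E; p \<in> ?AT\<rbrakk> \<Longrightarrow> u p = u1 p"
  proof (rule continuous_on_glue[OF compact_imp_closed[OF compact_broom_copy] AT, of "Y E" ?\<beta> u1])
    \<comment> \<open>Broom and arc meet only at the center of the extra broom, which both formulas
      send to \<open>plane 1 (m 0)\<close>.\<close>
    fix p assume p: "p \<in> Y E" "p \<in> broom_copy" "p \<in> ?AT"
    then obtain r where r: "p = extra_broom r" by (auto simp: broom_copy_eq)
    then have "p \<in> first_arc" using p(3) extra_broom_not_in_tail by auto
    then have "r = 0" "u1 p = ?\<phi> p" using extra_broom_in_first_arc r p u1(2) by auto
    then show "?\<beta> p = u1 p" by (simp add: r extra_broom_def g_center plane_def)
  qed (use Y_cover u1(1) \<beta>_cont in \<open>auto intro: continuous_on_subset\<close>)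
  have u_arc: "u p = ?\<phi> p" if "p \<in> first_arc" for p
    using u(3)[of p] u1(2)[of p] that first_arc_sub(2) by auto
  have u_tail: "u p = p" if "p \<in> Y E" "p \<in> tail_space" for p
    using u(3)[of p] u1(3)[of p] that by auto

  obtain i where i: "homeomorphism double_broom ?G (g 0) i"
    using homeomorphism_compact[OF compact_double_broom g_cont refl g_inj] by blast
  have ig: "i (g 0 r) = r" if "r \<in> double_broom" for r
    using i that by (auto simp: homeomorphism_def)
  \<comment> \<open>The norm of a point of the disk determines its image between
    \<open>x = -3/4\<close>, for the center, and \<open>x = -1\<close>, for the circle. The bound 1
    on the norm sends the other brooms to the center of the extra broom.\<close>
  let ?\<psi> = "\<lambda>p::real \<times> real \<times> real. (-3/4 - min 1 (norm (snd p) * ?D) / 4, 0 :: real \<times> real)"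
  let ?\<gamma> = "\<lambda>p::real \<times> real \<times> real. extra_broom (i (?D *\<^sub>R snd p))"
  have unplane_1: "?D *\<^sub>R snd (plane 1 q) = q" "norm (snd (plane 1 q)) * ?D = norm q" for q
    using D by (simp_all add: plane_def)
  note unplane = unplane_1 unplane_1[unfolded One_nat_def]
  have compact_C: "compact (plane 1 ` ?C)"
    by (rule compact_continuous_image[OF plane_continuous compact_disk_brooms])
  have compact_G: "compact (plane 1 ` ?G)"
    by (intro compact_continuous_image plane_continuous g_cont compact_double_broom)
  have CG: "q = m 0" if q: "q \<in> ?C" "q \<in> ?G" for q
  proof -
    have "q \<notin> g j ` double_broom" if "j \<noteq> 0" for j
      using g_disjoint[OF that] q(2) by blast
    then have "q \<in> cball 0 1" using q(1) by blast
    then show ?thesis using g_disk[of 0] q(2) by blast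
  qed
  have \<gamma>_cont: "continuous_on (plane 1 ` ?G) ?\<gamma>"
    by (rule continuous_on_compose2[OF extra_broom_continuous[of UNIV]
          continuous_on_compose2[OF homeomorphism_cont2[OF i]]])
      (auto simp only: image_image unplane(1) intro!: continuous_intros)
  let ?CG = "plane 1 ` ?C \<union> plane 1 ` ?G"
  obtain v1 where v1: "continuous_on ?CG v1"
    "\<And>p. \<lbrakk>p \<in> ?CG; p \<in> plane 1 ` ?C\<rbrakk> \<Longrightarrow> v1 p = ?\<psi> p"
    "\<And>p. \<lbrakk>p \<in> ?CG; p \<in> plane 1 ` ?G\<rbrakk> \<Longrightarrow> v1 p = ?\<gamma> p"
  proof (rule continuous_on_glue[OF compact_imp_closed[OF compact_C] compact_imp_closed[OF compact_G], of ?CG ?\<psi> ?\<gamma>])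
    fix p assume "p \<in> plane 1 ` ?C" "p \<in> plane 1 ` ?G"
    then obtain q q' where "p = plane 1 q" "p = plane 1 q'" "q \<in> ?C" "q' \<in> ?G" by blast
    then have "p = plane 1 (m 0)" using CG plane_eq_iff[of 1 q q'] by auto
    moreover have "i (m 0) = 0" using ig[of 0] by (simp add: g_center)
    ultimately show "?\<psi> p = ?\<gamma> p" by (simp add: unplane extra_broom_def)
  qed (use \<gamma>_cont in \<open>auto intro!: continuous_intros intro: continuous_on_subset\<close>)
  \<comment> \<open>The first arc is compressed into its second half, inverse to the second phase of
    \<open>?\<phi>\<close>.\<close>
  obtain v2 where v2: "continuous_on (X E \<inter> ?AT) v2"
    "\<And>p. \<lbrakk>p \<in> X E \<inter> ?AT; p \<in> first_arc\<rbrakk> \<Longrightarrow> v2 p = (fst p / 2 - 1/4, 0)"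
    "\<And>p. \<lbrakk>p \<in> X E \<inter> ?AT; p \<in> tail_space\<rbrakk> \<Longrightarrow> v2 p = p"
  proof (rule continuous_on_glue[OF closed_first_arc closed_tail_space, of "X E \<inter> ?AT" "\<lambda>p. (fst p / 2 - 1/4, 0)" "\<lambda>p. p"])
    fix p assume "p \<in> first_arc" "p \<in> tail_space"
    then have "p = (-1/2, 0)" by (rule first_arc_Int_tail)
    then show "(fst p / 2 - 1/4, 0) = p" by simp
  qed (auto intro!: continuous_intros)
  have plane_CG: "plane 1 ` H = ?CG" unfolding H_CG by (rule image_Un)
  \<comment> \<open>\<open>H(1)\<close> meets the first arc only in its own center and misses the
    tail; both formulas give \<open>x = -3/4\<close> there.\<close>
  have v12: "v1 p = v2 p" if p: "p \<in> X E" "p \<in> ?CG" "p \<in> ?AT" for p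
  proof -
    obtain q where q: "q \<in> H" "p = plane 1 q" using p(2) unfolding plane_CG[symmetric] by blast
    then have "p \<notin> tail_space" using plane_in_tail[of 1 q] by simp
    then have arc: "p \<in> first_arc" using p(3) by blast
    then have "p \<in> closed_axis" by (auto simp: first_arc_def closed_axis_def)
    then have "q = 0" using plane_in_axis[of 1 q] q by simp
    then have p0: "p = plane 1 0" using q by simp
    have "p \<in> plane 1 ` ?C" unfolding p0 by (rule imageI) simp
    then have "v1 p = ?\<psi> p" using p(2) by (intro v1(2))
    moreover have "v2 p = (fst p / 2 - 1/4, 0)" using v2(2)[of p] p(1,3) arc by blast
    ultimately show ?thesis by (simp add: p0 plane_zero)
  qed
  have closed_CG: "closed ?CG" using compact_C compact_G by (intro closed_Un compact_imp_closed)
  have cover: "X E \<subseteq> ?CG \<union> ?AT" using X_cover unfolding plane_CG[symmetric] by blast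
  have v1_cont: "continuous_on (X E \<inter> ?CG) v1" by (rule continuous_on_subset[OF v1(1)]) simp
  obtain v where v: "continuous_on (X E) v" "\<And>p. \<lbrakk>p \<in> X E; p \<in> ?CG\<rbrakk> \<Longrightarrow> v p = v1 p"
    "\<And>p. \<lbrakk>p \<in> X E; p \<in> ?AT\<rbrakk> \<Longrightarrow> v p = v2 p"
  proof (rule continuous_on_glue[OF closed_CG AT cover v1_cont v2(1)])
    fix p assume "p \<in> X E" "p \<in> ?CG" "p \<in> ?AT"
    then show "v1 p = v2 p" by (rule v12)
  next
    fix w assume "continuous_on (X E) w" "\<And>p. \<lbrakk>p \<in> X E; p \<in> ?CG\<rbrakk> \<Longrightarrow> w p = v1 p"
      "\<And>p. \<lbrakk>p \<in> X E; p \<in> ?AT\<rbrakk> \<Longrightarrow> w p = v2 p"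
    then show thesis by (rule that)
  qed
  have v_C: "v (plane 1 q) = ?\<psi> (plane 1 q)" if "q \<in> ?C" for q
  proof -
    have "q \<in> H" by (subst H_CG) (rule UnI1[OF that])
    then have X: "plane 1 q \<in> X E" by (intro plane_in_X[OF E]) simp_all
    have mem: "plane 1 q \<in> plane 1 ` ?C" using that by (rule imageI)
    from mem have CG: "plane 1 q \<in> ?CG" by (rule UnI1)
    show ?thesis using v(2)[OF X CG] v1(2)[OF CG mem] by (rule trans)
  qed
  have v_G: "v (plane 1 q) = ?\<gamma> (plane 1 q)" if "q \<in> ?G" for q
  proof -
    have "q \<in> H" by (subst H_CG) (rule UnI2[OF that])
    then have X: "plane 1 q \<in> X E" by (intro plane_in_X[OF E]) simp_all
    have mem: "plane 1 q \<in> plane 1 ` ?G" using that by (rule imageI)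
    from mem have CG: "plane 1 q \<in> ?CG" by (rule UnI2)
    show ?thesis using v(2)[OF X CG] v1(3)[OF CG mem] by (rule trans)
  qed
  have v_arc: "v p = (fst p / 2 - 1/4, 0)" if "p \<in> first_arc" for p
    using v(3)[of p] v2(2)[of p] that first_arc_sub(1) by auto
  have v_tail: "v p = p" if "p \<in> X E" "p \<in> tail_space" for p
    using v(3)[of p] v2(3)[of p] that by auto
  have axis_Y: "(x, 0) \<in> Y E" if "-1 \<le> x" "x < 0" for x
    using that by (auto simp: WBH_o_def axis_arcs_def zero_prod_def)
  \<comment> \<open>The two phases of \<open>?\<phi>\<close>; on the radius, \<open>t\<close> is the
    distance from the center before scaling.\<close>
  have arc_cases: "(\<exists>t. 0 \<le> t \<and> t \<le> 1 \<and> p = (-3/4 - t/4, 0) \<and> ?\<phi> p = plane 1 (t *\<^sub>R m 0)) \<or>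
      (\<exists>x. p = (x, 0) \<and> (2 * x + 1/2, 0) \<in> first_arc \<and> ?\<phi> p = (2 * x + 1/2, 0))"
    if p: "p \<in> first_arc" for p
  proof -
    obtain x where x: "p = (x, 0)" "-1 \<le> x" "x \<le> -1/2" using p by (auto simp: first_arc_def)
    show ?thesis
    proof (cases "x \<le> -3/4")
      case True
      define t where "t = - 4 * x - 3"
      have "x = - 3/4 - t/4" by (simp add: t_def field_simps)
      moreover have "?\<phi> p = plane 1 (t *\<^sub>R m 0)" using True x by (simp add: plane_def t_def)
      moreover have "0 \<le> t" "t \<le> 1" using True x by (simp_all add: t_def)
      ultimately show ?thesis using x(1) by (intro disjI1 exI[of _ t]) simp
    next
      case False
      then show ?thesis using x by (intro disjI2 exI[of _ x]) (auto simp: first_arc_def)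
    qed
  qed
  show ?thesis
  proof (rule hdominatedI[OF u(1) _ v(1)])
    have "u p \<in> X E \<and> v (u p) = p" if p: "p \<in> Y E" for p
    proof -
      consider "p \<in> broom_copy" | "p \<in> first_arc" | "p \<in> tail_space" using Y_cover[OF p] by blast
      then show ?thesis
      proof cases
        case 1
        then obtain r where r: "r \<in> double_broom" "p = extra_broom r" by (auto simp: broom_copy_eq)
        then have eq: "u p = plane 1 (g 0 r)" using u(2)[OF p 1] \<beta>_eq by simp
        have "v (u p) = p" unfolding eq using v_G[of "g 0 r"] r by (simp add: unplane ig)
        moreover have "u p \<in> X E"
          unfolding eq using plane_in_X[OF E, of 1 "g 0 r"] broom_subset_H[of 0] r by blast
        ultimately show ?thesis by blast
      next
        case 2
        from arc_cases[OF 2] show ?thesis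
        proof (elim disjE exE conjE)
          fix t assume t: "0 \<le> t" "t \<le> 1" "p = (-3/4 - t/4, 0)" "?\<phi> p = plane 1 (t *\<^sub>R m 0)"
          have eq: "u p = plane 1 (t *\<^sub>R m 0)" using u_arc[OF 2] t(4) by (rule trans)
          have in_disk: "t *\<^sub>R m 0 \<in> cball 0 1" using t by simp
          have "v (u p) = p" unfolding eq using v_C[OF UnI1[OF in_disk]] t by (simp add: unplane)
          moreover have "u p \<in> X E"
            unfolding eq using plane_in_X[OF E, of 1] subsetD[OF disk_subset_H in_disk] by simp
          ultimately show ?thesis by blast
        next
          fix x assume x: "p = (x, 0)" "(2 * x + 1/2, 0) \<in> first_arc" "?\<phi> p = (2 * x + 1/2, 0)"
          have eq: "u p = (2 * x + 1/2, 0)" using u_arc[OF 2] x(3) by (rule trans)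
          have "v (u p) = p" unfolding eq using v_arc[OF x(2)] x(1) by (simp add: add_divide_distrib)
          moreover have "u p \<in> X E" unfolding eq using x(2) first_arc_sub(1) by blast
          ultimately show ?thesis by blast
        qed
      next
        case 3
        then show ?thesis using u_tail[OF p 3] tail_eq[OF 3] p v_tail[OF _ 3] by auto
      qed
    qed
    then show "u \<in> Y E \<rightarrow> X E" "\<And>p. p \<in> Y E \<Longrightarrow> v (u p) = p" by blast+
    have v_plane: "v (plane 1 q) \<in> Y E" if "q \<in> H" for q
    proof (cases "q \<in> ?C")
      case True
      then have "v (plane 1 q) = (-3/4 - min 1 (norm q) / 4, 0)" using v_C[OF True] by (simp add: unplane)
      moreover have "0 \<le> min 1 (norm q)" "min 1 (norm q) \<le> 1" by auto
      then have "(-3/4 - min 1 (norm q) / 4, 0) \<in> Y E" by (intro axis_Y) linarith+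
      ultimately show ?thesis by (rule ssubst)
    next
      case False
      then obtain r where r: "r \<in> double_broom" "q = g 0 r" using \<open>q \<in> H\<close> unfolding H_CG by blast
      then have "v (plane 1 q) = extra_broom r" using v_G[of q] by (simp add: unplane ig)
      then show ?thesis using r by (auto simp: WBH_o_def broom_copy_eq)
    qed
    show "v \<in> X E \<rightarrow> Y E"
    proof
      fix p assume p: "p \<in> X E"
      then consider "p \<in> plane 1 ` H" | "p \<in> first_arc" | "p \<in> tail_space" using X_cover by blast
      then show "v p \<in> Y E"
      proof cases
        case 1
        then show ?thesis using v_plane by blast
      next
        case 2
        then have "-1 \<le> fst p / 2 - 1/4" "fst p / 2 - 1/4 < 0" by (auto simp: first_arc_def)
        then show ?thesis unfolding v_arc[OF 2] by (rule axis_Y)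
      next
        case 3
        then show ?thesis using v_tail[OF p 3] tail_eq[OF 3] p by simp
      qed
    qed
  qed
qed

end

end

lemma hairy_diskE:
  assumes "hairy_disk H"
  obtains m g where "hairy_disk_data H m g"
proof -
  from assms obtain m g where
    "range m \<subseteq> sphere 0 1" "sphere 0 1 \<subseteq> closure (range m)"
    "\<And>i. continuous_on double_broom (g i)" "\<And>i. inj_on (g i) double_broom"
    "\<And>i. g i (0, 0) = m i" "\<And>i. g i ` double_broom \<inter> cball 0 1 = {m i}"
    "\<And>i j. i \<noteq> j \<Longrightarrow> g i ` double_broom \<inter> g j ` double_broom = {}"
    "(\<lambda>i. diameter (g i ` double_broom)) \<longlonglongrightarrow> 0"
    "H = cball 0 1 \<union> (\<Union>i. g i ` double_broom)"
    unfolding hairy_disk_def by metis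
  then have "hairy_disk_data H m g"
    by unfold_locales (simp_all only: zero_prod_def)
  then show thesis by (rule that)
qed

theorem theorem3p4:
  assumes "hairy_disk H"
  shows "h_equal (WH_o H) (WBH_o H) \<and> \<not> (WH_o H homotopy_eqv WBH_o H) \<and>
         compact (WH H) \<and> compact (WBH H) \<and>
         h_equal (WH H) (WBH H) \<and> \<not> (WH H homotopy_eqv WBH H)"
proof -
  obtain m g where "hairy_disk_data H m g" using hairy_diskE[OF assms] .
  then interpret hairy_disk_data H m g .
  \<comment> \<open>The two choices of \<open>E\<close> give the pair without the limit point and
    the compact pair.\<close>
  have E: "{} \<subseteq> {0}" "{(0, 0, 0)} \<subseteq> {0 :: real \<times> real \<times> real}"
    by (auto simp: zero_prod_def)
  show ?thesis
    using hdominated_WH_WBH[OF E(1)] hdominated_WBH_WH[OF E(1)] not_homotopy_eqv[OF E(1)]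
      hdominated_WH_WBH[OF E(2)] hdominated_WBH_WH[OF E(2)] not_homotopy_eqv[OF E(2)]
      compact_WH compact_WBH
    by (simp add: h_equal_def WH_def WBH_def)
qed

end
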